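(* Let $1\le q<p<\infty$. Let $\Omega$ be a homogeneous space, let $\mu,\nu$ be measures on $\Omega$ with $\nu$ absolutely continuous with respect to $\mu$, and let $J=\frac{d\nu}{d\mu}$ be the Radon–Nikodým derivative. Let $\{B_\omega\}_{\omega\in\Omega}$ be a measurable family of Banach spaces over $(\Omega,\mu,V)$ and $\{D_\omega\}_{\omega\in\Omega}$ a measurable family of Banach spaces over $(\Omega,\nu,W)$. Then a measurable family of bounded linear operators $\{Q(\omega)\}_{\omega\in\Omega}$, $Q(\omega)\in\mathcal L(B_\omega,D_\omega)$, induces, by the rule $Qf(\omega)=Q(\omega)f(\omega)$, a bounded operator from $\left(\int_\Omega^\oplus B_\omega\,d\mu\right)_{L^p}$ to $\left(\int_\Omega^\oplus D_\omega\,d\nu\right)_{L^q}$ if and only if $$N(Q)\,J^{1/q}\in L^{\frac{pq}{p-q}}(\Omega,\mu).$$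
   Context: Measurable family of Banach spaces: Let $V$ be a vector space. A family of semi-norms $\{\|\cdot\|_\omega\}_{\omega\in\Omega}$ on $V$ is measurable if $\omega\mapsto\|v\|_\omega$ is measurable for each $v\in V$. $B_\omega$ is the completion of $V/\ker(\|\cdot\|_\omega)$ with respect to $\|\cdot\|_\omega$ (its norm is also written $\|\cdot\|_{B_\omega}$); the family $\{B_\omega\}$ is called a measurable family of Banach spaces over $(\Omega,\mu,V)$. Similarly for $\{D_\omega\}$ over $(\Omega,\nu,W)$. Sections and direct integrals: A section is a map $f:\Omega\to\bigcup_\omega B_\omega$ with $f(\omega)\in B_\omega$. A simple section has the form $\sum_{k=1}^n\chi_{A_k}(\omega)v_k$ with $v_k\in V$, $A_k$ measurable. A section $f$ is measurable if there are simple sections $h_k$ with $h_k(\omega)\to f(\omega)$ in $B_\omega$ for a.e. $\omega$. The direct integral $\int_\Omega^\oplus B_\omega\,d\mu$ is the space of a.e.-equivalence classes of measurable sections, and $\left(\int_\Omega^\oplus B_\omega\,d\mu\right)_{L^p}$ is the Banach space of those $f$ with $\left(\int_\Omega\|f(\omega)\|_\omega^p\,d\mu\right)^{1/p}<\infty$, with this norm. Homogeneous space: a quasimetric space with a Borel measure such that (1) there is $c_1\ge1$ such that whenever balls $B(t_1,r)$, $B(t_2,r)$ intersect, $B(t_2,r)\subset B(t_1,c_1r)$; (2) balls of positive radius have positive finite measure and there is a constant $c_2$ with $\mu(B(t,c_1r))\le c_2\,\mu(B(t,r))$. Homogeneous spaces are assumed to be $\sigma$-finite measure spaces. Measurable family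 of bounded linear operators: a map $\omega\mapsto Q(\omega)\in\mathcal L(B_\omega,D_\omega)$, defined for $\mu$-almost all $\omega$, such that (1) $\omega\mapsto Q(\omega)v$ is a measurable section of $\{D_\omega\}$ for every $v\in V$; (2) the operator norm $\|Q(\omega)\|$ is finite for $\mu$-a.e. $\omega$. Lattice supremum: for a family $\mathcal F$ of measurable functions, $\bigvee\mathcal F$ is the (a.e. unique) measurable function such that $f\le\bigvee\mathcal F$ a.e. for every $f\in\mathcal F$, and if $g$ is measurable with $f\le g$ a.e. for all $f\in\mathcal F$, then $\bigvee\mathcal F\le g$ a.e. Random norm: $N(Q)(\omega)=\bigvee\left\{\frac{\|Q(\omega)v\|_{D_\omega}}{\|v\|_{B_\omega}}:v\in V\right\}$, where the quotient is taken to be $0$ whenever $\|v\|_{B_\omega}=0$. *)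

theory Defs
  imports "HOL-Analysis.Analysis"
begin

section \<open>Normed spaces given by a carrier\<close>

text \<open>
  The fibres of a direct integral vary with the point of the base, so normed spaces are
  represented by explicit carriers. The scalar field is any \<^class>\<open>real_normed_field\<close>
  (of which \<^typ>\<open>real\<close> and \<^typ>\<open>complex\<close> are the instances of interest).
\<close>

record ('k, 'a) nspace =
  carr :: "'a set"
  add :: "'a \<Rightarrow> 'a \<Rightarrow> 'a"
  scl :: "'k \<Rightarrow> 'a \<Rightarrow> 'a"
  nrm :: "'a \<Rightarrow> real"

definition ndist :: "('k::real_normed_field, 'a) nspace \<Rightarrow> 'a \<Rightarrow> 'a \<Rightarrow> real" where
  "ndist X x y = nrm X (add X x (scl X (- 1) y))"

definition bounded_operator ::
  "('k::real_normed_field, 'a) nspace \<Rightarrow> ('k, 'b) nspace \<Rightarrow> ('a \<Rightarrow> 'b) \<Rightarrow> bool" where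
  "bounded_operator X Y T \<longleftrightarrow>
     (\<forall>x\<in>carr X. T x \<in> carr Y) \<and>
     (\<forall>x\<in>carr X. \<forall>y\<in>carr X. T (add X x y) = add Y (T x) (T y)) \<and>
     (\<forall>c. \<forall>x\<in>carr X. T (scl X c x) = scl Y c (T x)) \<and>
     (\<exists>C. \<forall>x\<in>carr X. nrm Y (T x) \<le> C * nrm X x)"

section \<open>Completion of a seminormed space\<close>

definition is_seminorm :: "('k::real_normed_field \<Rightarrow> 'v::ab_group_add \<Rightarrow> 'v) \<Rightarrow> ('v \<Rightarrow> real) \<Rightarrow> bool" where
  "is_seminorm s n \<longleftrightarrow>
     (\<forall>v. 0 \<le> n v) \<and> (\<forall>v w. n (v + w) \<le> n v + n w) \<and> (\<forall>c v. n (s c v) = norm c * n v)"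

definition cauchy_seqs :: "('v::ab_group_add \<Rightarrow> real) \<Rightarrow> (nat \<Rightarrow> 'v) set" where
  "cauchy_seqs n = {X. \<forall>e>0. \<exists>M. \<forall>i\<ge>M. \<forall>j\<ge>M. n (X i - X j) < e}"

definition null_rel :: "('v::ab_group_add \<Rightarrow> real) \<Rightarrow> ((nat \<Rightarrow> 'v) \<times> (nat \<Rightarrow> 'v)) set" where
  "null_rel n = {(X, Y). X \<in> cauchy_seqs n \<and> Y \<in> cauchy_seqs n \<and> (\<lambda>k. n (X k - Y k)) \<longlonglongrightarrow> 0}"

text \<open>
  The completion of V/ker n: Cauchy sequences of V for the seminorm n modulo null sequences.
  This divides out ker n and completes in one step, since vectors that differ by an element of
  ker n give constant sequences in the same class. The norm of a class is the common value of
  lim n (X k) over its representatives X.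
\<close>

definition completion ::
  "('k::real_normed_field \<Rightarrow> 'v::ab_group_add \<Rightarrow> 'v) \<Rightarrow> ('v \<Rightarrow> real) \<Rightarrow> ('k, (nat \<Rightarrow> 'v) set) nspace" where
  "completion s n = \<lparr>
     carr = cauchy_seqs n // null_rel n,
     add = (\<lambda>x y. \<Union>X\<in>x. \<Union>Y\<in>y. null_rel n `` {\<lambda>k. X k + Y k}),
     scl = (\<lambda>c x. \<Union>X\<in>x. null_rel n `` {\<lambda>k. s c (X k)}),
     nrm = (\<lambda>x. the_elem ((\<lambda>X. lim (\<lambda>k. n (X k))) ` x)) \<rparr>"

definition embed :: "('v::ab_group_add \<Rightarrow> real) \<Rightarrow> 'v \<Rightarrow> (nat \<Rightarrow> 'v) set" where
  "embed n v = null_rel n `` {\<lambda>k. v}"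

section \<open>Measurable families, sections, direct integrals\<close>

text \<open>
  A measurable family of Banach spaces over (\<Omega>, M, V) is given by the scalar multiplication s of V
  and the seminorms n \<omega>; its fibre at \<omega> is \<open>completion s (n \<omega>)\<close>.
\<close>

definition measurable_banach_family ::
  "'o measure \<Rightarrow> ('k::real_normed_field \<Rightarrow> 'v::ab_group_add \<Rightarrow> 'v) \<Rightarrow> ('o \<Rightarrow> 'v \<Rightarrow> real) \<Rightarrow> bool" where
  "measurable_banach_family M s n \<longleftrightarrow>
     vector_space s \<and>
     (\<forall>\<omega>\<in>space M. is_seminorm s (n \<omega>)) \<and>
     (\<forall>v. (\<lambda>\<omega>. n \<omega> v) \<in> borel_measurable M)"

definition simple_section ::
  "'o measure \<Rightarrow> ('k::real_normed_field \<Rightarrow> 'v::ab_group_add \<Rightarrow> 'v) \<Rightarrow> ('o \<Rightarrow> 'v \<Rightarrow> real) \<Rightarrow>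
   ('o \<Rightarrow> (nat \<Rightarrow> 'v) set) \<Rightarrow> bool" where
  "simple_section M s n h \<longleftrightarrow>
     (\<exists>(N::nat) A v. (\<forall>k<N. A k \<in> sets M) \<and>
        h = (\<lambda>\<omega>. embed (n \<omega>) (\<Sum>k<N. s (indicator (A k) \<omega>) (v k))))"

text \<open>
  Sections only matter up to a.e. equality, so f \<omega> is required to lie in the fibre for almost
  every \<omega> only. This allows \<open>\<lambda>\<omega>. Q \<omega> (f \<omega>)\<close> to be a section when Q is defined a.e.
\<close>

definition measurable_section ::
  "'o measure \<Rightarrow> ('k::real_normed_field \<Rightarrow> 'v::ab_group_add \<Rightarrow> 'v) \<Rightarrow> ('o \<Rightarrow> 'v \<Rightarrow> real) \<Rightarrow>
   ('o \<Rightarrow> (nat \<Rightarrow> 'v) set) \<Rightarrow> bool" where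
  "measurable_section M s n f \<longleftrightarrow>
     (AE \<omega> in M. f \<omega> \<in> carr (completion s (n \<omega>))) \<and>
     (\<exists>h. (\<forall>k::nat. simple_section M s n (h k)) \<and>
          (AE \<omega> in M. (\<lambda>k. ndist (completion s (n \<omega>)) (h k \<omega>) (f \<omega>)) \<longlonglongrightarrow> 0))"

definition section_rel ::
  "'o measure \<Rightarrow> ('k::real_normed_field \<Rightarrow> 'v::ab_group_add \<Rightarrow> 'v) \<Rightarrow> ('o \<Rightarrow> 'v \<Rightarrow> real) \<Rightarrow>
   (('o \<Rightarrow> (nat \<Rightarrow> 'v) set) \<times> ('o \<Rightarrow> (nat \<Rightarrow> 'v) set)) set" where
  "section_rel M s n =
     {(f, g). measurable_section M s n f \<and> measurable_section M s n g \<and> (AE \<omega> in M. f \<omega> = g \<omega>)}"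

definition direct_integral ::
  "'o measure \<Rightarrow> ('k::real_normed_field \<Rightarrow> 'v::ab_group_add \<Rightarrow> 'v) \<Rightarrow> ('o \<Rightarrow> 'v \<Rightarrow> real) \<Rightarrow>
   ('o \<Rightarrow> (nat \<Rightarrow> 'v) set) set set" where
  "direct_integral M s n = Collect (measurable_section M s n) // section_rel M s n"

text \<open>
  The sigma-algebra of M need not be complete, so for a measurable section f the function
  \<open>\<lambda>\<omega>. nrm _ (f \<omega>)\<close> is in general only a.e. equal to a measurable one; \<^const>\<open>nn_integral\<close>
  (unlike the Bochner integral) is insensitive to this.
\<close>

definition section_int ::
  "'o measure \<Rightarrow> ('k::real_normed_field \<Rightarrow> 'v::ab_group_add \<Rightarrow> 'v) \<Rightarrow> ('o \<Rightarrow> 'v \<Rightarrow> real) \<Rightarrow> real \<Rightarrow>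
   ('o \<Rightarrow> (nat \<Rightarrow> 'v) set) \<Rightarrow> ennreal" where
  "section_int M s n p f = (\<integral>\<^sup>+ \<omega>. ennreal (nrm (completion s (n \<omega>)) (f \<omega>) powr p) \<partial>M)"

definition direct_integral_Lp ::
  "'o measure \<Rightarrow> ('k::real_normed_field \<Rightarrow> 'v::ab_group_add \<Rightarrow> 'v) \<Rightarrow> ('o \<Rightarrow> 'v \<Rightarrow> real) \<Rightarrow> real \<Rightarrow>
   ('k, ('o \<Rightarrow> (nat \<Rightarrow> 'v) set) set) nspace" where
  "direct_integral_Lp M s n p = \<lparr>
     carr = {F \<in> direct_integral M s n. \<forall>f\<in>F. section_int M s n p f < \<infinity>},
     add = (\<lambda>F G. \<Union>f\<in>F. \<Union>g\<in>G.
              section_rel M s n `` {\<lambda>\<omega>. add (completion s (n \<omega>)) (f \<omega>) (g \<omega>)}),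
     scl = (\<lambda>c F. \<Union>f\<in>F. section_rel M s n `` {\<lambda>\<omega>. scl (completion s (n \<omega>)) c (f \<omega>)}),
     nrm = (\<lambda>F. the_elem ((\<lambda>f. enn2real (section_int M s n p f) powr (1 / p)) ` F)) \<rparr>"

section \<open>Homogeneous spaces\<close>

definition quasimetric :: "('o \<Rightarrow> 'o \<Rightarrow> real) \<Rightarrow> bool" where
  "quasimetric d \<longleftrightarrow>
     (\<forall>x y. 0 \<le> d x y) \<and> (\<forall>x y. d x y = 0 \<longleftrightarrow> x = y) \<and> (\<forall>x y. d x y = d y x) \<and>
     (\<exists>K\<ge>1. \<forall>x y z. d x z \<le> K * (d x y + d y z))"

definition qball :: "('o \<Rightarrow> 'o \<Rightarrow> real) \<Rightarrow> 'o \<Rightarrow> real \<Rightarrow> 'o set" where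
  "qball d t r = {x. d t x < r}"

definition qopen :: "('o \<Rightarrow> 'o \<Rightarrow> real) \<Rightarrow> 'o set \<Rightarrow> bool" where
  "qopen d U \<longleftrightarrow> (\<forall>x\<in>U. \<exists>r>0. qball d x r \<subseteq> U)"

text \<open>Balls of a quasimetric need not be open, so their measurability is a separate condition.\<close>

definition homogeneous_space :: "('o \<Rightarrow> 'o \<Rightarrow> real) \<Rightarrow> 'o measure \<Rightarrow> bool" where
  "homogeneous_space d m \<longleftrightarrow>
     quasimetric d \<and>
     space m = UNIV \<and> sets m = sigma_sets UNIV (Collect (qopen d)) \<and> sigma_finite_measure m \<and>
     (\<exists>c1\<ge>1.
        (\<forall>t1 t2 r. qball d t1 r \<inter> qball d t2 r \<noteq> {} \<longrightarrow> qball d t2 r \<subseteq> qball d t1 (c1 * r)) \<and>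
        (\<forall>t. \<forall>r>0. qball d t r \<in> sets m \<and> 0 < emeasure m (qball d t r) \<and>
                   emeasure m (qball d t r) < \<infinity>) \<and>
        (\<exists>c2::real. \<forall>t. \<forall>r>0. measure m (qball d t (c1 * r)) \<le> c2 * measure m (qball d t r)))"

section \<open>Operator families and their random norm\<close>

text \<open>
  Measurability of \<open>\<lambda>\<omega>. Q \<omega> v\<close> refers to the family of the D \<omega>, which lives over N, whereas Q is
  defined (and has finite operator norm) for M-almost every \<omega>.
\<close>

definition measurable_operator_family ::
  "'o measure \<Rightarrow> ('k::real_normed_field \<Rightarrow> 'v::ab_group_add \<Rightarrow> 'v) \<Rightarrow> ('o \<Rightarrow> 'v \<Rightarrow> real) \<Rightarrow>
   'o measure \<Rightarrow> ('k \<Rightarrow> 'w::ab_group_add \<Rightarrow> 'w) \<Rightarrow> ('o \<Rightarrow> 'w \<Rightarrow> real) \<Rightarrow>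
   ('o \<Rightarrow> (nat \<Rightarrow> 'v) set \<Rightarrow> (nat \<Rightarrow> 'w) set) \<Rightarrow> bool" where
  "measurable_operator_family M s n N t l Q \<longleftrightarrow>
     (AE \<omega> in M. bounded_operator (completion s (n \<omega>)) (completion t (l \<omega>)) (Q \<omega>)) \<and>
     (\<forall>v. measurable_section N t l (\<lambda>\<omega>. Q \<omega> (embed (n \<omega>) v)))"

text \<open>
  The functions in the family need not be measurable: the quotients in the definition of the
  random norm below are known to be (a.e. equal to) measurable functions only where the density
  of N with respect to M is positive.
\<close>

definition is_lattice_sup :: "'o measure \<Rightarrow> ('o \<Rightarrow> ennreal) set \<Rightarrow> ('o \<Rightarrow> ennreal) \<Rightarrow> bool" where
  "is_lattice_sup M F g \<longleftrightarrow>
     g \<in> borel_measurable M \<and> (\<forall>f\<in>F. AE \<omega> in M. f \<omega> \<le> g \<omega>) \<and>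
     (\<forall>g'\<in>borel_measurable M. (\<forall>f\<in>F. AE \<omega> in M. f \<omega> \<le> g' \<omega>) \<longrightarrow> (AE \<omega> in M. g \<omega> \<le> g' \<omega>))"

definition lattice_sup :: "'o measure \<Rightarrow> ('o \<Rightarrow> ennreal) set \<Rightarrow> 'o \<Rightarrow> ennreal" where
  "lattice_sup M F = (SOME g. is_lattice_sup M F g)"

text \<open>Division by 0 on \<^typ>\<open>real\<close> gives the convention that the quotient is 0 if the denominator is.\<close>

definition random_norm ::
  "'o measure \<Rightarrow> ('k::real_normed_field \<Rightarrow> 'v::ab_group_add \<Rightarrow> 'v) \<Rightarrow> ('o \<Rightarrow> 'v \<Rightarrow> real) \<Rightarrow>
   ('k \<Rightarrow> 'w::ab_group_add \<Rightarrow> 'w) \<Rightarrow> ('o \<Rightarrow> 'w \<Rightarrow> real) \<Rightarrow>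
   ('o \<Rightarrow> (nat \<Rightarrow> 'v) set \<Rightarrow> (nat \<Rightarrow> 'w) set) \<Rightarrow> 'o \<Rightarrow> ennreal" where
  "random_norm M s n t l Q =
     lattice_sup M (range (\<lambda>v \<omega>. ennreal
       (nrm (completion t (l \<omega>)) (Q \<omega> (embed (n \<omega>) v)) /
        nrm (completion s (n \<omega>)) (embed (n \<omega>) v))))"

definition induces_bounded_operator ::
  "'o measure \<Rightarrow> ('k::real_normed_field \<Rightarrow> 'v::ab_group_add \<Rightarrow> 'v) \<Rightarrow> ('o \<Rightarrow> 'v \<Rightarrow> real) \<Rightarrow> real \<Rightarrow>
   'o measure \<Rightarrow> ('k \<Rightarrow> 'w::ab_group_add \<Rightarrow> 'w) \<Rightarrow> ('o \<Rightarrow> 'w \<Rightarrow> real) \<Rightarrow> real \<Rightarrow>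
   ('o \<Rightarrow> (nat \<Rightarrow> 'v) set \<Rightarrow> (nat \<Rightarrow> 'w) set) \<Rightarrow> bool" where
  "induces_bounded_operator M s n p N t l q Q \<longleftrightarrow>
     (\<exists>T. bounded_operator (direct_integral_Lp M s n p) (direct_integral_Lp N t l q) T \<and>
          (\<forall>F\<in>carr (direct_integral_Lp M s n p). \<forall>f\<in>F. (\<lambda>\<omega>. Q \<omega> (f \<omega>)) \<in> T F))"

text \<open>Real powers of extended nonnegative reals; meaningful for exponents a > 0.\<close>

definition enn_powr :: "ennreal \<Rightarrow> real \<Rightarrow> ennreal" where
  "enn_powr x a = (if x = \<infinity> then \<infinity> else ennreal (enn2real x powr a))"

definition in_Lp :: "'o measure \<Rightarrow> real \<Rightarrow> ('o \<Rightarrow> ennreal) \<Rightarrow> bool" where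
  "in_Lp M r g \<longleftrightarrow> g \<in> borel_measurable M \<and> (\<integral>\<^sup>+ \<omega>. enn_powr (g \<omega>) r \<partial>M) < \<infinity>"

end

theory Submission
  imports Defs
begin

text \<open>
  Write r = pq / (p - q), so that 1 / q = 1 / p + 1 / r. For a measurable section f one has
  \<open>\<parallel>Q(\<omega>) f(\<omega>)\<parallel> \<le> N(Q)(\<omega>) \<parallel>f(\<omega>)\<parallel>\<close> a.e., and \<open>d\<nu> = J d\<mu>\<close>, so the condition on \<open>N(Q) J\<^sup>1\<^sup>/\<^sup>q\<close>
  gives boundedness by Hoelder's inequality.

  Conversely, on \<open>{J > 0}\<close> the random norm is the supremum of countably many quotients
  \<open>\<phi>\<^sub>i = \<parallel>Q(\<omega>) c\<^sub>i\<parallel> / \<parallel>c\<^sub>i\<parallel>\<close>. Let G be a truncation of the maximum of \<open>\<phi>\<^sub>i J\<^sup>1\<^sup>/\<^sup>q\<close> over finitely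
  many i, and let f be \<open>G\<^sup>r\<^sup>/\<^sup>p c\<^sub>i / \<parallel>c\<^sub>i\<parallel>\<close> with a measurable choice of an index i such that
  \<open>G \<le> \<phi>\<^sub>i J\<^sup>1\<^sup>/\<^sup>q\<close>. Testing Q on f bounds the integral of \<open>G\<^sup>r\<close> by the r-th power of the
  operator norm, and monotone convergence removes the truncation.
\<close>

section \<open>Countably valued measurable functions\<close>

text \<open>Two obstacles shape the proof. V carries no \<sigma>-algebra and need not be separable
  for any of the seminorms. Sections are therefore built from functions with countably many values
  and measurable level sets. Unlike simple functions, these can be glued along countable partitions
  and selected pointwise, and \<open>measurable_sectionI\<close> leads back to simple sections. This
  is how Q(\<omega>) f(\<omega>) is shown to be measurable and how the test section gets a vector
  depending on \<omega>. The random norm is a lattice supremum over a possibly uncountable family.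
  It dominates each member only off a null set of that member, and measurable versions of the
  quotients are available only where J > 0. On \<open>{J = 0}\<close> the random norm is not
  controlled at all, but the factor J^(1/q) is 0 there and 0 * top = 0. The truncation of G secures
  finiteness. Testing gives K^(1/q) <= C K^(1/p) for K the integral of G^r, and K^(1/r) <= C follows
  by division only when K is finite.\<close>

definition countably_valued :: "'o measure \<Rightarrow> ('o \<Rightarrow> 'x) \<Rightarrow> bool" where
  "countably_valued M u \<longleftrightarrow>
     countable (u ` space M) \<and> (\<forall>x. {\<omega> \<in> space M. u \<omega> = x} \<in> sets M)"

lemma countably_valued_const: "countably_valued M (\<lambda>\<omega>. x)"
  unfolding countably_valued_def by (auto intro: countable_subset[of _ "{x}"])

lemma countably_valued_Union:
  assumes "countably_valued M u" and "\<And>x. {\<omega> \<in> space M. P x \<omega>} \<in> sets M"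
  shows "{\<omega> \<in> space M. P (u \<omega>) \<omega>} \<in> sets M"
proof -
  have "{\<omega> \<in> space M. P (u \<omega>) \<omega>} =
    (\<Union>x\<in>u ` space M. {\<omega> \<in> space M. u \<omega> = x} \<inter> {\<omega> \<in> space M. P x \<omega>})"
    by auto
  also have "\<dots> \<in> sets M"
    using assms unfolding countably_valued_def
    by (intro sets.countable_UN' sets.Int) auto
  finally show ?thesis .
qed

text \<open>Gluing along a countable partition is the closure property that simple functions lack:
  finitely many values on each of infinitely many pieces are in general infinitely many. Pasting of
  sections and diagonal selection rest on it.\<close>

lemma countably_valued_compose:
  assumes u: "countably_valued M u" and g: "\<And>x. countably_valued M (g x)"
  shows "countably_valued M (\<lambda>\<omega>. g (u \<omega>) \<omega>)"
  unfolding countably_valued_def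
proof (intro conjI allI)
  have "countable (\<Union>x\<in>u ` space M. g x ` space M)"
  proof (rule countable_UN)
    show "countable (u ` space M)" using u unfolding countably_valued_def by blast
    show "countable (g x ` space M)" for x using g[of x] unfolding countably_valued_def by blast
  qed
  moreover have "(\<lambda>\<omega>. g (u \<omega>) \<omega>) ` space M \<subseteq> (\<Union>x\<in>u ` space M. g x ` space M)"
    by (rule image_subsetI) (rule UN_I, rule imageI, assumption, rule imageI)
  ultimately show "countable ((\<lambda>\<omega>. g (u \<omega>) \<omega>) ` space M)"
    by (rule countable_subset[rotated])
  show "{\<omega> \<in> space M. g (u \<omega>) \<omega> = x} \<in> sets M" for x
    by (rule countably_valued_Union[OF u]) (use g in \<open>simp add: countably_valued_def\<close>)
qed

lemma countably_valued_comp: "countably_valued M u \<Longrightarrow> countably_valued M (\<lambda>\<omega>. g (u \<omega>))"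
  using countably_valued_compose[of M u "\<lambda>x _. g x"] by (simp add: countably_valued_const)

lemma countably_valued_comp2:
  assumes "countably_valued M u" "countably_valued M w"
  shows "countably_valued M (\<lambda>\<omega>. g (u \<omega>) (w \<omega>))"
  by (rule countably_valued_compose[OF assms(1)]) (rule countably_valued_comp[OF assms(2)])

lemma countably_valued_indicator:
  "A \<in> sets M \<Longrightarrow> countably_valued M (indicator A :: _ \<Rightarrow> 'x::zero_neq_one)"
  unfolding countably_valued_def
proof (intro conjI allI)
  assume A: "A \<in> sets M"
  show "countable ((indicator A :: _ \<Rightarrow> 'x) ` space M)"
    by (rule countable_subset[of _ "{0, 1}"]) (auto simp: indicator_def)
  show "{\<omega> \<in> space M. indicator A \<omega> = x} \<in> sets M" for x :: 'x
  proof -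
    have "{\<omega> \<in> space M. indicator A \<omega> = x} =
      (if x = 1 then A \<inter> space M else if x = 0 then space M - A else {})"
      by (auto simp: indicator_def)
    then show ?thesis using A by auto
  qed
qed

lemma countably_valued_count_space:
  assumes "u \<in> measurable M (count_space (UNIV :: 'x::countable set))"
  shows "countably_valued M u"
  unfolding countably_valued_def
proof (intro conjI allI)
  show "{\<omega> \<in> space M. u \<omega> = x} \<in> sets M" for x
  proof -
    have "{\<omega> \<in> space M. u \<omega> = x} = u -` {x} \<inter> space M" by auto
    then show ?thesis using measurable_sets[OF assms, of "{x}"] by simp
  qed
qed simp

lemma borel_measurable_countably_valued:
  fixes F :: "'x \<Rightarrow> 'o \<Rightarrow> 'r::topological_space"
  assumes u: "countably_valued M u" and F: "\<And>x. F x \<in> borel_measurable M"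
  shows "(\<lambda>\<omega>. F (u \<omega>) \<omega>) \<in> borel_measurable M"
proof (rule measurableI)
  fix A :: "'r set" assume A: "A \<in> sets borel"
  have "(\<lambda>\<omega>. F (u \<omega>) \<omega>) -` A \<inter> space M = {\<omega> \<in> space M. F (u \<omega>) \<omega> \<in> A}"
    by auto
  also have "\<dots> \<in> sets M"
  proof (rule countably_valued_Union[OF u])
    fix x
    have "{\<omega> \<in> space M. F x \<omega> \<in> A} = F x -` A \<inter> space M" by auto
    then show "{\<omega> \<in> space M. F x \<omega> \<in> A} \<in> sets M"
      using measurable_sets[OF F A] by simp
  qed
  finally show "(\<lambda>\<omega>. F (u \<omega>) \<omega>) -` A \<inter> space M \<in> sets M" .
qed simp

lemma squeeze_zero:
  fixes f g :: "'i \<Rightarrow> real"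
  assumes "(g \<longlongrightarrow> 0) F" "\<And>k. 0 \<le> f k" "\<And>k. f k \<le> g k"
  shows "(f \<longlongrightarrow> 0) F"
  using tendsto_sandwich[OF _ _ tendsto_const assms(1), of f] assms(2,3) by simp

section \<open>Completion of a seminormed space\<close>

locale seminormed = vector_space s
  for s :: "'k::real_normed_field \<Rightarrow> 'v::ab_group_add \<Rightarrow> 'v" +
  fixes n :: "'v \<Rightarrow> real"
  assumes seminorm: "is_seminorm s n"
begin

lemma n_nonneg: "0 \<le> n v"
  and n_triangle: "n (v + w) \<le> n v + n w"
  and n_scale: "n (s c v) = norm c * n v"
  using seminorm unfolding is_seminorm_def by blast+

lemma n_zero [simp]: "n 0 = 0"
  using n_scale[of 0 0] by simp

lemma n_minus: "n (- v) = n v"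
  using n_scale[of "- 1" v] by simp

lemma n_diff_commute: "n (v - w) = n (w - v)"
  using n_minus[of "v - w"] by simp

lemma n_triangle_diff: "n (u - w) \<le> n (u - v) + n (v - w)"
  using n_triangle[of "u - v" "v - w"] by simp

lemma n_abs_diff: "\<bar>n v - n w\<bar> \<le> n (v - w)"
  using n_triangle[of "v - w" w] n_triangle[of "w - v" v] n_diff_commute[of v w] by simp

lemma n_add_diff: "n ((v + w) - (v' + w')) \<le> n (v - v') + n (w - w')"
  using n_triangle[of "v - v'" "w - w'"] by (simp add: algebra_simps)

lemma n_scale_diff: "n (s c v - s c w) = norm c * n (v - w)"
  using n_scale[of c "v - w"] by (simp add: scale_right_diff_distrib)

lemma cauchy_seqsD:
  "X \<in> cauchy_seqs n \<Longrightarrow> e > 0 \<Longrightarrow> \<exists>M. \<forall>i\<ge>M. \<forall>j\<ge>M. n (X i - X j) < e"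
  unfolding cauchy_seqs_def by blast

lemma const_cauchy: "(\<lambda>k. v) \<in> cauchy_seqs n"
  unfolding cauchy_seqs_def by simp

lemma add_cauchy:
  assumes "X \<in> cauchy_seqs n" "Y \<in> cauchy_seqs n"
  shows "(\<lambda>k. X k + Y k) \<in> cauchy_seqs n"
  unfolding cauchy_seqs_def
proof (intro CollectI allI impI)
  fix e :: real assume "e > 0"
  then obtain M M' where M: "\<And>i j. i \<ge> M \<Longrightarrow> j \<ge> M \<Longrightarrow> n (X i - X j) < e / 2"
    and M': "\<And>i j. i \<ge> M' \<Longrightarrow> j \<ge> M' \<Longrightarrow> n (Y i - Y j) < e / 2"
    using cauchy_seqsD[OF assms(1) half_gt_zero] cauchy_seqsD[OF assms(2) half_gt_zero] by meson
  show "\<exists>M. \<forall>i\<ge>M. \<forall>j\<ge>M. n (X i + Y i - (X j + Y j)) < e"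
  proof (intro exI allI impI)
    fix i j assume "i \<ge> max M M'" "j \<ge> max M M'"
    then show "n (X i + Y i - (X j + Y j)) < e"
      using M[of i j] M'[of i j] n_add_diff[of "X i" "Y i" "X j" "Y j"] by simp
  qed
qed

lemma scale_cauchy:
  assumes "X \<in> cauchy_seqs n"
  shows "(\<lambda>k. s c (X k)) \<in> cauchy_seqs n"
  unfolding cauchy_seqs_def
proof (intro CollectI allI impI)
  fix e :: real assume "e > 0"
  \<comment> \<open>The summand 1 keeps the denominator positive when c = 0.\<close>
  then have "e / (norm c + 1) > 0"
    by (simp add: add_nonneg_pos)
  then obtain M where M: "\<And>i j. i \<ge> M \<Longrightarrow> j \<ge> M \<Longrightarrow> n (X i - X j) < e / (norm c + 1)"
    using cauchy_seqsD[OF assms] by blast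
  show "\<exists>M. \<forall>i\<ge>M. \<forall>j\<ge>M. n (s c (X i) - s c (X j)) < e"
  proof (intro exI allI impI)
    fix i j assume "i \<ge> M" "j \<ge> M"
    have "norm c * n (X i - X j) \<le> (norm c + 1) * n (X i - X j)"
      using n_nonneg by (simp add: mult_right_mono)
    also have "\<dots> < e"
      using M[OF \<open>i \<ge> M\<close> \<open>j \<ge> M\<close>] by (simp add: pos_less_divide_eq add_nonneg_pos mult.commute)
    finally show "n (s c (X i) - s c (X j)) < e"
      by (simp add: n_scale_diff)
  qed
qed

lemma diff_cauchy:
  assumes "X \<in> cauchy_seqs n" "Y \<in> cauchy_seqs n"
  shows "(\<lambda>k. X k - Y k) \<in> cauchy_seqs n"
  using add_cauchy[OF assms(1) scale_cauchy[OF assms(2), of "- 1"]] by simp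

lemma n_convergent:
  assumes "X \<in> cauchy_seqs n"
  shows "convergent (\<lambda>k. n (X k))"
proof -
  have "Cauchy (\<lambda>k. n (X k))"
    unfolding Cauchy_def dist_real_def
    using cauchy_seqsD[OF assms] n_abs_diff by (meson le_less_trans)
  then show ?thesis by (rule Cauchy_convergent)
qed

section \<open>The quotient by null sequences\<close>

lemma null_rel_iff:
  "(X, Y) \<in> null_rel n \<longleftrightarrow>
    X \<in> cauchy_seqs n \<and> Y \<in> cauchy_seqs n \<and> (\<lambda>k. n (X k - Y k)) \<longlonglongrightarrow> 0"
  unfolding null_rel_def by simp

lemma equiv_null_rel: "equiv (cauchy_seqs n) (null_rel n)"
proof (rule equivI)
  show "null_rel n \<subseteq> cauchy_seqs n \<times> cauchy_seqs n"
    unfolding null_rel_def by auto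
  show "refl_on (cauchy_seqs n) (null_rel n)"
    by (rule refl_onI) (simp add: null_rel_iff)
  show "sym (null_rel n)"
  proof (rule symI)
    fix X Y assume "(X, Y) \<in> null_rel n"
    moreover have "(\<lambda>k. n (X k - Y k)) = (\<lambda>k. n (Y k - X k))"
      by (rule ext) (rule n_diff_commute)
    ultimately show "(Y, X) \<in> null_rel n" unfolding null_rel_iff by simp
  qed
  show "trans (null_rel n)"
  proof (rule transI)
    fix X Y Z assume XYZ: "(X, Y) \<in> null_rel n" "(Y, Z) \<in> null_rel n"
    then have "(\<lambda>k. n (X k - Y k)) \<longlonglongrightarrow> 0" "(\<lambda>k. n (Y k - Z k)) \<longlonglongrightarrow> 0"
      unfolding null_rel_iff by blast+
    from tendsto_add[OF this] have "(\<lambda>k. n (X k - Y k) + n (Y k - Z k)) \<longlonglongrightarrow> 0"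
      by simp
    then have "(\<lambda>k. n (X k - Z k)) \<longlonglongrightarrow> 0"
      by (rule squeeze_zero) (rule n_nonneg, rule n_triangle_diff)
    with XYZ show "(X, Z) \<in> null_rel n" unfolding null_rel_iff by blast
  qed
qed

abbreviation cls :: "(nat \<Rightarrow> 'v) \<Rightarrow> (nat \<Rightarrow> 'v) set" where
  "cls X \<equiv> null_rel n `` {X}"

lemma carrE:
  assumes "x \<in> carr (completion s n)"
  obtains X where "X \<in> cauchy_seqs n" "x = cls X"
  using assms unfolding completion_def by (auto elim!: quotientE)

lemma cls_carr: "X \<in> cauchy_seqs n \<Longrightarrow> cls X \<in> carr (completion s n)"
  unfolding completion_def by (simp add: quotientI)

lemma cls_self: "X \<in> cauchy_seqs n \<Longrightarrow> X \<in> cls X"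
  using equiv_class_self[OF equiv_null_rel] .

lemma cls_nonempty: "X \<in> cauchy_seqs n \<Longrightarrow> cls X \<noteq> {}"
  using cls_self by blast

text \<open>The \<open>the_elem\<close> in the norm is meaningful because equivalent sequences have
  the same limit of seminorms, by the reverse triangle inequality. With \<open>ndist_cls\<close>,
  this is the bridge by which inequalities for representatives pass to classes in the limit.\<close>

lemma nrm_cls:
  assumes X: "X \<in> cauchy_seqs n"
  shows "(\<lambda>k. n (X k)) \<longlonglongrightarrow> nrm (completion s n) (cls X)"
proof -
  have lim: "(\<lambda>k. n (X k)) \<longlonglongrightarrow> lim (\<lambda>k. n (X k))"
    using n_convergent[OF X] by (simp add: convergent_LIMSEQ_iff)
  have "lim (\<lambda>k. n (Y k)) = lim (\<lambda>k. n (X k))" if "Y \<in> cls X" for Y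
  proof -
    have "(\<lambda>k. n (X k - Y k)) \<longlonglongrightarrow> 0"
      using that by (simp add: null_rel_iff)
    then have "(\<lambda>k. \<bar>n (X k) - n (Y k)\<bar>) \<longlonglongrightarrow> 0"
      by (rule squeeze_zero) (rule abs_ge_zero, rule n_abs_diff)
    then have "(\<lambda>k. n (X k) - n (Y k)) \<longlonglongrightarrow> 0"
      by (simp only: tendsto_rabs_zero_iff)
    from tendsto_diff[OF lim this] have "(\<lambda>k. n (Y k)) \<longlonglongrightarrow> lim (\<lambda>k. n (X k))"
      by simp
    then show ?thesis by (rule limI)
  qed
  then have "(\<lambda>Y. lim (\<lambda>k. n (Y k))) ` cls X = (\<lambda>Y. lim (\<lambda>k. n (X k))) ` cls X"
    by (rule image_cong[OF refl])
  also have "\<dots> = {lim (\<lambda>k. n (X k))}"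
    using cls_self[OF X] by blast
  finally have "(\<lambda>Y. lim (\<lambda>k. n (Y k))) ` cls X = {lim (\<lambda>k. n (X k))}" .
  then have "nrm (completion s n) (cls X) = lim (\<lambda>k. n (X k))"
    unfolding completion_def by simp
  with lim show ?thesis by simp
qed

text \<open>The operation is a union over all representatives. It collapses to one class because
  sums of null sequences are null and because both classes are nonempty.\<close>

lemma add_cls:
  assumes X: "X \<in> cauchy_seqs n" and Y: "Y \<in> cauchy_seqs n"
  shows "add (completion s n) (cls X) (cls Y) = cls (\<lambda>k. X k + Y k)"
proof -
  have "cls (\<lambda>k. X' k + Y' k) = cls (\<lambda>k. X k + Y k)" if "X' \<in> cls X" "Y' \<in> cls Y" for X' Y'
  proof (rule equiv_class_eq[OF equiv_null_rel], unfold null_rel_iff, intro conjI)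
    have *: "X' \<in> cauchy_seqs n" "Y' \<in> cauchy_seqs n"
      "(\<lambda>k. n (X k - X' k)) \<longlonglongrightarrow> 0" "(\<lambda>k. n (Y k - Y' k)) \<longlonglongrightarrow> 0"
      using that by (auto simp: null_rel_iff)
    show "(\<lambda>k. X' k + Y' k) \<in> cauchy_seqs n" "(\<lambda>k. X k + Y k) \<in> cauchy_seqs n"
      using * X Y by (auto intro: add_cauchy)
    from tendsto_add[OF *(3,4)]
    have "(\<lambda>k. n (X k - X' k) + n (Y k - Y' k)) \<longlonglongrightarrow> 0" by simp
    then have "(\<lambda>k. n (X k + Y k - (X' k + Y' k))) \<longlonglongrightarrow> 0"
      by (rule squeeze_zero) (rule n_nonneg, rule n_add_diff)
    then show "(\<lambda>k. n (X' k + Y' k - (X k + Y k))) \<longlonglongrightarrow> 0"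
      by (simp add: n_diff_commute[of "X' _ + Y' _"])
  qed
  then have "(\<Union>X'\<in>cls X. \<Union>Y'\<in>cls Y. cls (\<lambda>k. X' k + Y' k)) = cls (\<lambda>k. X k + Y k)"
    by (rule SUP_eq_const[OF cls_nonempty[OF X] SUP_eq_const[OF cls_nonempty[OF Y]]])
  then show ?thesis unfolding completion_def by simp
qed

lemma scl_cls:
  assumes X: "X \<in> cauchy_seqs n"
  shows "scl (completion s n) c (cls X) = cls (\<lambda>k. s c (X k))"
proof -
  have "cls (\<lambda>k. s c (X' k)) = cls (\<lambda>k. s c (X k))" if "X' \<in> cls X" for X'
  proof (rule equiv_class_eq[OF equiv_null_rel], unfold null_rel_iff, intro conjI)
    have *: "X' \<in> cauchy_seqs n" "(\<lambda>k. n (X k - X' k)) \<longlonglongrightarrow> 0"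
      using that by (auto simp: null_rel_iff)
    show "(\<lambda>k. s c (X' k)) \<in> cauchy_seqs n" "(\<lambda>k. s c (X k)) \<in> cauchy_seqs n"
      using * X by (auto intro: scale_cauchy)
    show "(\<lambda>k. n (s c (X' k) - s c (X k))) \<longlonglongrightarrow> 0"
      using tendsto_mult_left[OF *(2), of "norm c"] n_diff_commute[of "X' _" "X _"]
      by (simp add: n_scale_diff)
  qed
  then have "(\<Union>X'\<in>cls X. cls (\<lambda>k. s c (X' k))) = cls (\<lambda>k. s c (X k))"
    by (rule SUP_eq_const[OF cls_nonempty[OF X]])
  then show ?thesis unfolding completion_def by simp
qed

lemma ndist_cls:
  assumes X: "X \<in> cauchy_seqs n" and Y: "Y \<in> cauchy_seqs n"
  shows "(\<lambda>k. n (X k - Y k)) \<longlonglongrightarrow> ndist (completion s n) (cls X) (cls Y)"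
  using nrm_cls[OF diff_cauchy[OF X Y]]
  unfolding ndist_def scl_cls[OF Y] add_cls[OF X scale_cauchy[OF Y]] by simp

lemma embed_carr [simp]: "embed n v \<in> carr (completion s n)"
  unfolding embed_def by (rule cls_carr[OF const_cauchy])

lemma nrm_embed [simp]: "nrm (completion s n) (embed n v) = n v"
  using nrm_cls[OF const_cauchy[of v]] unfolding embed_def by (simp add: LIMSEQ_const_iff)

lemma add_embed [simp]: "add (completion s n) (embed n v) (embed n w) = embed n (v + w)"
  unfolding embed_def by (simp add: add_cls const_cauchy)

lemma scl_embed [simp]: "scl (completion s n) c (embed n v) = embed n (s c v)"
  unfolding embed_def by (simp add: scl_cls const_cauchy)

lemma ndist_embed [simp]: "ndist (completion s n) (embed n v) (embed n w) = n (v - w)"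
  unfolding ndist_def by simp

context
  fixes x y
  assumes x: "x \<in> carr (completion s n)" and y: "y \<in> carr (completion s n)"
begin

lemma add_carr: "add (completion s n) x y \<in> carr (completion s n)"
  using x y by (auto elim!: carrE simp: add_cls intro!: cls_carr add_cauchy)

lemma scl_carr: "scl (completion s n) c x \<in> carr (completion s n)"
  using x by (auto elim!: carrE simp: scl_cls intro!: cls_carr scale_cauchy)

lemma nrm_nonneg: "0 \<le> nrm (completion s n) x"
  using x by (auto elim!: carrE intro!: LIMSEQ_le_const[OF nrm_cls] n_nonneg)

lemma ndist_nonneg: "0 \<le> ndist (completion s n) x y"
  using x y by (auto elim!: carrE intro!: LIMSEQ_le_const[OF ndist_cls] n_nonneg)

lemma ndist_commute: "ndist (completion s n) x y = ndist (completion s n) y x"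
proof -
  obtain X Y where XY: "X \<in> cauchy_seqs n" "x = cls X" "Y \<in> cauchy_seqs n" "y = cls Y"
    using x y by (auto elim!: carrE)
  have "(\<lambda>k. n (X k - Y k)) = (\<lambda>k. n (Y k - X k))"
    by (rule ext) (rule n_diff_commute)
  then show ?thesis
    unfolding XY(2,4) using LIMSEQ_unique[OF ndist_cls[OF XY(1,3)]] ndist_cls[OF XY(3,1)] by metis
qed

lemma abs_nrm_diff: "\<bar>nrm (completion s n) x - nrm (completion s n) y\<bar> \<le> ndist (completion s n) x y"
proof -
  obtain X Y where XY: "X \<in> cauchy_seqs n" "x = cls X" "Y \<in> cauchy_seqs n" "y = cls Y"
    using x y by (auto elim!: carrE)
  show ?thesis
    unfolding XY(2,4)
    by (rule LIMSEQ_le[OF tendsto_rabs[OF tendsto_diff[OF nrm_cls nrm_cls]] ndist_cls])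
      (use XY n_abs_diff in auto)
qed

lemma nrm_scl: "nrm (completion s n) (scl (completion s n) c x) = norm c * nrm (completion s n) x"
proof -
  obtain X where X: "X \<in> cauchy_seqs n" "x = cls X"
    using x by (auto elim!: carrE)
  show ?thesis
    unfolding X(2) scl_cls[OF X(1)]
    by (rule LIMSEQ_unique[OF nrm_cls[OF scale_cauchy[OF X(1)]]])
      (unfold n_scale, rule tendsto_mult_left[OF nrm_cls[OF X(1)]])
qed

lemma ndist_scl: "ndist (completion s n) (scl (completion s n) c x) (scl (completion s n) c y)
    = norm c * ndist (completion s n) x y"
proof -
  obtain X Y where XY: "X \<in> cauchy_seqs n" "x = cls X" "Y \<in> cauchy_seqs n" "y = cls Y"
    using x y by (auto elim!: carrE)
  show ?thesis
    unfolding XY(2,4) scl_cls[OF XY(1)] scl_cls[OF XY(3)]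
    by (rule LIMSEQ_unique[OF ndist_cls[OF scale_cauchy[OF XY(1)] scale_cauchy[OF XY(3)]]])
      (unfold n_scale_diff, rule tendsto_mult_left[OF ndist_cls[OF XY(1,3)]])
qed

lemma ndist_triangle:
  assumes z: "z \<in> carr (completion s n)"
  shows "ndist (completion s n) x z \<le> ndist (completion s n) x y + ndist (completion s n) y z"
proof -
  obtain X Y Z where XY: "X \<in> cauchy_seqs n" "x = cls X" "Y \<in> cauchy_seqs n" "y = cls Y"
     "Z \<in> cauchy_seqs n" "z = cls Z"
    using x y z by (auto elim!: carrE)
  show ?thesis
    unfolding XY(2,4,6)
    by (rule LIMSEQ_le[OF ndist_cls tendsto_add[OF ndist_cls ndist_cls]])
      (use XY n_triangle_diff in auto)
qed

lemma ndist_add: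
  assumes x': "x' \<in> carr (completion s n)" and y': "y' \<in> carr (completion s n)"
  shows "ndist (completion s n) (add (completion s n) x y) (add (completion s n) x' y')
    \<le> ndist (completion s n) x x' + ndist (completion s n) y y'"
proof -
  obtain X Y X' Y' where XY: "X \<in> cauchy_seqs n" "x = cls X" "Y \<in> cauchy_seqs n" "y = cls Y"
     "X' \<in> cauchy_seqs n" "x' = cls X'" "Y' \<in> cauchy_seqs n" "y' = cls Y'"
    using x y x' y' by (auto elim!: carrE)
  show ?thesis
    unfolding XY(2,4,6,8) add_cls[OF XY(1,3)] add_cls[OF XY(5,7)]
    by (rule LIMSEQ_le[OF ndist_cls tendsto_add[OF ndist_cls ndist_cls]])
      (use XY n_add_diff in \<open>auto intro: add_cauchy\<close>)
qed

end

end

section \<open>Measurable sections\<close>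

text \<open>Numbering the values has two uses: a.e. statements about single vectors can be
  intersected over all values taken, and there is an index at which to truncate.\<close>

lemma countably_valued_nat:
  assumes u: "countably_valued M u"
  obtains I :: "'o \<Rightarrow> nat" and c where "countably_valued M I" "\<And>\<omega>. \<omega> \<in> space M \<Longrightarrow> u \<omega> = c (I \<omega>)"
proof
  let ?U = "u ` space M"
  show "countably_valued M (\<lambda>\<omega>. to_nat_on ?U (u \<omega>))"
    by (rule countably_valued_comp[OF u])
  show "u \<omega> = from_nat_into ?U (to_nat_on ?U (u \<omega>))" if "\<omega> \<in> space M" for \<omega>
    using u that unfolding countably_valued_def by simp
qed

text \<open>
  Only the null sets of L matter. Having a finite measure allows the truncation of countably valued
  functions to simple ones by Borel-Cantelli also when M, like the target measure below, is not
  \<open>\<sigma>\<close>-finite.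
\<close>

locale banach_family =
  fixes M L :: "'o measure"
    and s :: "'k::real_normed_field \<Rightarrow> 'v::ab_group_add \<Rightarrow> 'v"
    and n :: "'o \<Rightarrow> 'v \<Rightarrow> real"
  assumes family: "measurable_banach_family M s n"
    and finite_L: "finite_measure L"
    and sets_L: "sets L = sets M"
    and abs_cont_L: "absolutely_continuous L M"
begin

lemma fibre: "\<omega> \<in> space M \<Longrightarrow> seminormed s (n \<omega>)"
  using family unfolding measurable_banach_family_def seminormed_def seminormed_axioms_def by blast

lemma n_measurable: "(\<lambda>\<omega>. n \<omega> v) \<in> borel_measurable M"
  using family unfolding measurable_banach_family_def by blast

lemma vs: "vector_space s"
  using family unfolding measurable_banach_family_def by blast

lemma n_countably_valued: "countably_valued M u \<Longrightarrow> (\<lambda>\<omega>. n \<omega> (u \<omega>)) \<in> borel_measurable M"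
  using borel_measurable_countably_valued[where F = "\<lambda>v \<omega>. n \<omega> v"] n_measurable by blast

abbreviation fib :: "'o \<Rightarrow> ('k, (nat \<Rightarrow> 'v) set) nspace" where
  "fib \<omega> \<equiv> completion s (n \<omega>)"

abbreviation emb :: "('o \<Rightarrow> 'v) \<Rightarrow> 'o \<Rightarrow> (nat \<Rightarrow> 'v) set" where
  "emb u \<omega> \<equiv> embed (n \<omega>) (u \<omega>)"

lemma simple_section_countably_valued:
  assumes "simple_section M s n h"
  obtains u where "countably_valued M u" "h = emb u"
proof -
  obtain N A v where A: "\<And>k. k < (N::nat) \<Longrightarrow> A k \<in> sets M"
    and h: "h = emb (\<lambda>\<omega>. \<Sum>k<N. s (indicator (A k) \<omega>) (v k))"
    using assms unfolding simple_section_def by blast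
  have "countably_valued M (\<lambda>\<omega>. \<Sum>k<j. s (indicator (A k) \<omega>) (v k))" if "j \<le> N" for j
    using that
  proof (induction j)
    case 0
    then show ?case by (simp add: countably_valued_const)
  next
    case (Suc j)
    have "countably_valued M (indicator (A j) :: 'o \<Rightarrow> 'k)"
      using A Suc.prems by (simp add: countably_valued_indicator)
    with Suc countably_valued_comp2[of M "\<lambda>\<omega>. \<Sum>k<j. s (indicator (A k) \<omega>) (v k)"
        "indicator (A j) :: 'o \<Rightarrow> 'k" "\<lambda>x a. x + s a (v j)"]
    show ?case by simp
  qed
  with h show ?thesis using that by blast
qed

lemma simple_section_truncation:
  assumes I: "countably_valued M (I :: 'o \<Rightarrow> nat)"
  shows "\<exists>h. simple_section M s n h \<and> (\<forall>\<omega>\<in>space M. I \<omega> < j \<longrightarrow> h \<omega> = embed (n \<omega>) (c (I \<omega>)))"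
proof -
  interpret vector_space s by (rule vs)
  let ?A = "\<lambda>i. {\<omega> \<in> space M. I \<omega> = i}"
  let ?h = "emb (\<lambda>\<omega>. \<Sum>i<j. s (indicator (?A i) \<omega>) (c i))"
  have "simple_section M s n ?h"
    unfolding simple_section_def using I
    by (intro exI[of _ j] exI[of _ ?A] exI[of _ c]) (simp add: countably_valued_def)
  moreover have "?h \<omega> = embed (n \<omega>) (c (I \<omega>))" if "\<omega> \<in> space M" "I \<omega> < j" for \<omega>
  proof -
    have "(\<Sum>i<j. s (indicator (?A i) \<omega>) (c i)) = (\<Sum>i<j. if i = I \<omega> then c i else 0)"
      using that(1) by (intro sum.cong) auto
    also have "\<dots> = c (I \<omega>)" using that(2) by (simp add: sum.delta)
    finally show ?thesis by simp
  qed
  ultimately show ?thesis by blast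
qed

lemma AE_L: "AE \<omega> in L. P \<omega> \<Longrightarrow> AE \<omega> in M. P \<omega>"
  by (rule absolutely_continuous_AE[of M L]) (simp_all add: sets_L abs_cont_L)

lemma space_L: "space L = space M"
  by (rule sets_eq_imp_space_eq[OF sets_L])

text \<open>The tails \<open>{j \<le> I}\<close> decrease to the empty set, and finiteness of L
  makes their measures tend to 0.\<close>

lemma simple_section_approx:
  assumes u: "countably_valued M u" and e: "e > (0::real)"
  shows "\<exists>h A. simple_section M s n h \<and> A \<in> sets M \<and> measure L A < e \<and>
    (\<forall>\<omega>\<in>space M - A. h \<omega> = emb u \<omega>)"
proof -
  obtain I :: "'o \<Rightarrow> nat" and c where I: "countably_valued M I"
    and c: "\<And>\<omega>. \<omega> \<in> space M \<Longrightarrow> u \<omega> = c (I \<omega>)"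
    by (rule countably_valued_nat[OF u]) (rule that)
  let ?A = "\<lambda>j. {\<omega> \<in> space M. j \<le> I \<omega>}"
  have A: "?A j \<in> sets M" for j
    by (rule countably_valued_Union[OF I]) simp
  have "(\<lambda>j. measure L (?A j)) \<longlonglongrightarrow> measure L (\<Inter>j. ?A j)"
    using A by (intro finite_measure.finite_Lim_measure_decseq[OF finite_L])
      (auto simp: sets_L decseq_def)
  moreover have "(\<Inter>j. ?A j) = {}"
    by auto (metis Suc_n_not_le_n)
  ultimately have "(\<lambda>j. measure L (?A j)) \<longlonglongrightarrow> 0"
    by simp
  then have "eventually (\<lambda>j. measure L (?A j) < e) sequentially"
    by (rule order_tendstoD) (rule e)
  then obtain j where j: "measure L (?A j) < e"
    by (auto simp: eventually_sequentially)
  obtain h where "simple_section M s n h"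
    "\<And>\<omega>. \<omega> \<in> space M \<Longrightarrow> I \<omega> < j \<Longrightarrow> h \<omega> = embed (n \<omega>) (c (I \<omega>))"
    using simple_section_truncation[OF I, of j c] by blast
  then show ?thesis
    using A[of j] j c by (intro exI[of _ h] exI[of _ "?A j"]) (simp add: not_le)
qed

text \<open>Replace the k-th approximant by a simple section off a set of L-measure below 2^(-k).
  Almost every point lies in only finitely many of these sets, so there the two sequences agree from
  some index on and have the same limit.\<close>

lemma measurable_sectionI:
  assumes f: "AE \<omega> in M. f \<omega> \<in> carr (fib \<omega>)"
    and u: "\<And>k::nat. countably_valued M (u k)"
    and lim: "AE \<omega> in M. (\<lambda>k. ndist (fib \<omega>) (emb (u k) \<omega>) (f \<omega>)) \<longlonglongrightarrow> 0"
  shows "measurable_section M s n f"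
proof -
  have "\<exists>h A. simple_section M s n h \<and> A \<in> sets M \<and> measure L A < (1 / 2) ^ k \<and>
    (\<forall>\<omega>\<in>space M - A. h \<omega> = emb (u k) \<omega>)" for k
    by (rule simple_section_approx[OF u]) simp
  then obtain h A where h: "\<And>k. simple_section M s n (h k)" and A: "\<And>k. A k \<in> sets M"
    and mA: "\<And>k. measure L (A k) < (1 / 2) ^ k"
    and hu: "\<And>k \<omega>. \<omega> \<in> space M - A k \<Longrightarrow> h k \<omega> = emb (u k) \<omega>"
    by metis
  have "AE \<omega> in L. eventually (\<lambda>k. \<omega> \<in> space L - A k) sequentially"
  proof (rule borel_cantelli_AE1)
    show "A k \<in> sets L" for k using A sets_L by simp
    show "emeasure L (A k) < \<infinity>" for k
      using finite_measure.emeasure_finite[OF finite_L, of "A k"] by (simp add: less_top)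
    show "summable (\<lambda>k. measure L (A k))"
      by (rule summable_comparison_test[OF _ summable_geometric[of "1 / 2 :: real"]])
        (use mA in \<open>auto intro!: exI[of _ 0] less_imp_le\<close>)
  qed
  then have "AE \<omega> in M. eventually (\<lambda>k. \<omega> \<in> space L - A k) sequentially"
    by (rule AE_L)
  with lim have "AE \<omega> in M. (\<lambda>k. ndist (fib \<omega>) (h k \<omega>) (f \<omega>)) \<longlonglongrightarrow> 0"
  proof eventually_elim
    case (elim \<omega>)
    have "eventually (\<lambda>k. ndist (fib \<omega>) (emb (u k) \<omega>) (f \<omega>) = ndist (fib \<omega>) (h k \<omega>) (f \<omega>)) sequentially"
      using elim(2) by (rule eventually_mono) (simp add: hu space_L)
    then show ?case using elim(1) by (rule Lim_transform_eventually[rotated])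
  qed
  with f h show ?thesis unfolding measurable_section_def by blast
qed

lemma measurable_section_carr:
  "measurable_section M s n f \<Longrightarrow> AE \<omega> in M. f \<omega> \<in> carr (fib \<omega>)"
  unfolding measurable_section_def by blast

lemma measurable_sectionE:
  assumes "measurable_section M s n f"
  obtains u where "\<And>k::nat. countably_valued M (u k)"
    "AE \<omega> in M. (\<lambda>k. ndist (fib \<omega>) (emb (u k) \<omega>) (f \<omega>)) \<longlonglongrightarrow> 0"
proof -
  obtain h where h: "\<And>k. simple_section M s n (h k)"
    and lim: "AE \<omega> in M. (\<lambda>k. ndist (fib \<omega>) (h k \<omega>) (f \<omega>)) \<longlonglongrightarrow> 0"
    using assms unfolding measurable_section_def by blast
  have "\<exists>u. countably_valued M u \<and> h k = emb u" for k
    using simple_section_countably_valued[OF h] by metis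
  then obtain u where u: "\<And>k. countably_valued M (u k)" and hu: "\<And>k. h k = emb (u k)"
    by metis
  show ?thesis by (rule that[OF u]) (rule lim[unfolded hu])
qed

lemma section_AE_cong:
  assumes f: "measurable_section M s n f" and fg: "AE \<omega> in M. f \<omega> = g \<omega>"
  shows "measurable_section M s n g"
proof -
  obtain u where u: "\<And>k::nat. countably_valued M (u k)"
    and lim: "AE \<omega> in M. (\<lambda>k. ndist (fib \<omega>) (emb (u k) \<omega>) (f \<omega>)) \<longlonglongrightarrow> 0"
    by (rule measurable_sectionE[OF f]) (rule that)
  show ?thesis
  proof (rule measurable_sectionI[OF _ u])
    show "AE \<omega> in M. g \<omega> \<in> carr (fib \<omega>)"
      using measurable_section_carr[OF f] fg by eventually_elim simp
    show "AE \<omega> in M. (\<lambda>k. ndist (fib \<omega>) (emb (u k) \<omega>) (g \<omega>)) \<longlonglongrightarrow> 0"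
      using lim fg by eventually_elim simp
  qed
qed

lemma section_nrm:
  assumes f: "measurable_section M s n f"
  obtains g where "g \<in> borel_measurable M" "\<And>\<omega>. 0 \<le> g \<omega>"
    "AE \<omega> in M. nrm (fib \<omega>) (f \<omega>) = g \<omega>"
proof -
  obtain u where u: "\<And>k::nat. countably_valued M (u k)"
    and lim: "AE \<omega> in M. (\<lambda>k. ndist (fib \<omega>) (emb (u k) \<omega>) (f \<omega>)) \<longlonglongrightarrow> 0"
    by (rule measurable_sectionE[OF f]) (rule that)
  \<comment> \<open>Where the sequence diverges, \<open>lim\<close> is an unspecified real. The
    absolute value makes g nonnegative everywhere and changes nothing where the limit is the
    norm.\<close>
  let ?g = "\<lambda>\<omega>. \<bar>lim (\<lambda>k. n \<omega> (u k \<omega>))\<bar>"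
  have "?g \<in> borel_measurable M"
    by (intro borel_measurable_abs borel_measurable_lim_metric n_countably_valued u)
  moreover have "AE \<omega> in M. nrm (fib \<omega>) (f \<omega>) = ?g \<omega>"
    using lim measurable_section_carr[OF f] AE_space
  proof eventually_elim
    case (elim \<omega>)
    interpret seminormed s "n \<omega>" by (rule fibre) (rule elim)
    have "(\<lambda>k. \<bar>n \<omega> (u k \<omega>) - nrm (fib \<omega>) (f \<omega>)\<bar>) \<longlonglongrightarrow> 0"
    proof (rule squeeze_zero[OF elim(1)])
      show "\<bar>n \<omega> (u k \<omega>) - nrm (fib \<omega>) (f \<omega>)\<bar> \<le> ndist (fib \<omega>) (emb (u k) \<omega>) (f \<omega>)" for k
        using abs_nrm_diff[OF embed_carr elim(2), of "u k \<omega>"] by simp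
    qed simp
    then have "(\<lambda>k. n \<omega> (u k \<omega>)) \<longlonglongrightarrow> nrm (fib \<omega>) (f \<omega>)"
      by (simp add: tendsto_rabs_zero_iff LIM_zero_iff)
    then show ?case using nrm_nonneg[OF elim(2) elim(2)] by (simp add: limI)
  qed
  ultimately show ?thesis using that[of ?g] by simp
qed

lemma section_add:
  assumes f: "measurable_section M s n f" and g: "measurable_section M s n g"
  shows "measurable_section M s n (\<lambda>\<omega>. add (fib \<omega>) (f \<omega>) (g \<omega>))"
proof -
  obtain u where u: "\<And>k::nat. countably_valued M (u k)"
    and limu: "AE \<omega> in M. (\<lambda>k. ndist (fib \<omega>) (emb (u k) \<omega>) (f \<omega>)) \<longlonglongrightarrow> 0"
    by (rule measurable_sectionE[OF f]) (rule that)
  obtain w where w: "\<And>k::nat. countably_valued M (w k)"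
    and limw: "AE \<omega> in M. (\<lambda>k. ndist (fib \<omega>) (emb (w k) \<omega>) (g \<omega>)) \<longlonglongrightarrow> 0"
    by (rule measurable_sectionE[OF g]) (rule that)
  show ?thesis
  proof (rule measurable_sectionI)
    show "AE \<omega> in M. add (fib \<omega>) (f \<omega>) (g \<omega>) \<in> carr (fib \<omega>)"
      using measurable_section_carr[OF f] measurable_section_carr[OF g] AE_space
      by eventually_elim (rule seminormed.add_carr[OF fibre])
    show "countably_valued M (\<lambda>\<omega>. u k \<omega> + w k \<omega>)" for k
      by (rule countably_valued_comp2[OF u w])
    show "AE \<omega> in M. (\<lambda>k. ndist (fib \<omega>) (embed (n \<omega>) (u k \<omega> + w k \<omega>))
        (add (fib \<omega>) (f \<omega>) (g \<omega>))) \<longlonglongrightarrow> 0"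
      using limu limw measurable_section_carr[OF f] measurable_section_carr[OF g] AE_space
    proof eventually_elim
      case (elim \<omega>)
      interpret seminormed s "n \<omega>" by (rule fibre) (rule elim)
      have "(\<lambda>k. ndist (fib \<omega>) (emb (u k) \<omega>) (f \<omega>) + ndist (fib \<omega>) (emb (w k) \<omega>) (g \<omega>)) \<longlonglongrightarrow> 0"
        using tendsto_add[OF elim(1,2)] by simp
      then show ?case
      proof (rule squeeze_zero)
        fix k
        show "0 \<le> ndist (fib \<omega>) (embed (n \<omega>) (u k \<omega> + w k \<omega>)) (add (fib \<omega>) (f \<omega>) (g \<omega>))"
          by (rule ndist_nonneg[OF embed_carr add_carr[OF elim(3,4)]])
        show "ndist (fib \<omega>) (embed (n \<omega>) (u k \<omega> + w k \<omega>)) (add (fib \<omega>) (f \<omega>) (g \<omega>))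
          \<le> ndist (fib \<omega>) (emb (u k) \<omega>) (f \<omega>) + ndist (fib \<omega>) (emb (w k) \<omega>) (g \<omega>)"
          using ndist_add[OF embed_carr embed_carr elim(3,4), of "u k \<omega>" "w k \<omega>"] by simp
      qed
    qed
  qed
qed

lemma section_scl:
  assumes f: "measurable_section M s n f"
  shows "measurable_section M s n (\<lambda>\<omega>. scl (fib \<omega>) c (f \<omega>))"
proof -
  obtain u where u: "\<And>k::nat. countably_valued M (u k)"
    and lim: "AE \<omega> in M. (\<lambda>k. ndist (fib \<omega>) (emb (u k) \<omega>) (f \<omega>)) \<longlonglongrightarrow> 0"
    by (rule measurable_sectionE[OF f]) (rule that)
  show ?thesis
  proof (rule measurable_sectionI)
    show "AE \<omega> in M. scl (fib \<omega>) c (f \<omega>) \<in> carr (fib \<omega>)"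
      using measurable_section_carr[OF f] AE_space
      by eventually_elim (rule seminormed.scl_carr[OF fibre])
    show "countably_valued M (\<lambda>\<omega>. s c (u k \<omega>))" for k
      by (rule countably_valued_comp[OF u])
    show "AE \<omega> in M. (\<lambda>k. ndist (fib \<omega>) (embed (n \<omega>) (s c (u k \<omega>))) (scl (fib \<omega>) c (f \<omega>))) \<longlonglongrightarrow> 0"
      using lim measurable_section_carr[OF f] AE_space
    proof eventually_elim
      case (elim \<omega>)
      interpret seminormed s "n \<omega>" by (rule fibre) (rule elim)
      have "ndist (fib \<omega>) (embed (n \<omega>) (s c (u k \<omega>))) (scl (fib \<omega>) c (f \<omega>))
        = norm c * ndist (fib \<omega>) (emb (u k) \<omega>) (f \<omega>)" for k
        using ndist_scl[OF embed_carr elim(2), of c "u k \<omega>"] by simp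
      then show ?case using tendsto_mult_left[OF elim(1), of "norm c"] by simp
    qed
  qed
qed

text \<open>The indices are natural numbers, so the exceptional null sets of all the sections f i
  can be discarded at once.\<close>

lemma section_paste:
  assumes I: "countably_valued M (I :: 'o \<Rightarrow> nat)" and f: "\<And>i. measurable_section M s n (f i)"
  shows "measurable_section M s n (\<lambda>\<omega>. f (I \<omega>) \<omega>)"
proof -
  have "\<forall>i. \<exists>u. (\<forall>k. countably_valued M (u k)) \<and>
    (AE \<omega> in M. (\<lambda>k. ndist (fib \<omega>) (emb (u k) \<omega>) (f i \<omega>)) \<longlonglongrightarrow> 0)"
    by (intro allI) (rule measurable_sectionE[OF f], blast)
  from choice[OF this] obtain u where "\<forall>i. (\<forall>k. countably_valued M (u i k)) \<and>
    (AE \<omega> in M. (\<lambda>k. ndist (fib \<omega>) (emb (u i k) \<omega>) (f i \<omega>)) \<longlonglongrightarrow> 0)" ..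
  then have u: "\<And>i k. countably_valued M (u i k)"
    and lim: "\<And>i. AE \<omega> in M. (\<lambda>k. ndist (fib \<omega>) (emb (u i k) \<omega>) (f i \<omega>)) \<longlonglongrightarrow> 0"
    by blast+
  show ?thesis
  proof (rule measurable_sectionI)
    have "AE \<omega> in M. \<forall>i. f i \<omega> \<in> carr (fib \<omega>)"
      unfolding AE_all_countable using measurable_section_carr[OF f] by blast
    then show "AE \<omega> in M. f (I \<omega>) \<omega> \<in> carr (fib \<omega>)"
      by eventually_elim blast
    show "countably_valued M (\<lambda>\<omega>. u (I \<omega>) k \<omega>)" for k
      by (rule countably_valued_compose[OF I]) (rule u)
    have "AE \<omega> in M. \<forall>i. (\<lambda>k. ndist (fib \<omega>) (emb (u i k) \<omega>) (f i \<omega>)) \<longlonglongrightarrow> 0"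
      unfolding AE_all_countable using lim by blast
    then show "AE \<omega> in M. (\<lambda>k. ndist (fib \<omega>) (embed (n \<omega>) (u (I \<omega>) k \<omega>)) (f (I \<omega>) \<omega>)) \<longlonglongrightarrow> 0"
      by eventually_elim blast
  qed
qed

text \<open>A fixed diagonal k = K(j) does not suffice, since the approximation of g j is only
  pointwise with no uniform rate. The index is chosen measurably in \<omega> instead, and the
  resulting diagonal is countably valued, though not simple.\<close>

lemma section_limit:
  assumes g: "\<And>j::nat. measurable_section M s n (g j)"
    and f: "AE \<omega> in M. f \<omega> \<in> carr (fib \<omega>)"
    and lim: "AE \<omega> in M. (\<lambda>j. ndist (fib \<omega>) (g j \<omega>) (f \<omega>)) \<longlonglongrightarrow> 0"
  shows "measurable_section M s n f"
proof -
  have "\<forall>j. \<exists>u. (\<forall>k. countably_valued M (u k)) \<and>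
    (AE \<omega> in M. (\<lambda>k. ndist (fib \<omega>) (emb (u k) \<omega>) (g j \<omega>)) \<longlonglongrightarrow> 0)"
    by (intro allI) (rule measurable_sectionE[OF g], blast)
  from choice[OF this] obtain u where "\<forall>j. (\<forall>k. countably_valued M (u j k)) \<and>
    (AE \<omega> in M. (\<lambda>k. ndist (fib \<omega>) (emb (u j k) \<omega>) (g j \<omega>)) \<longlonglongrightarrow> 0)" ..
  then have u: "\<And>j k. countably_valued M (u j k)"
    and limu: "\<And>j. AE \<omega> in M. (\<lambda>k. ndist (fib \<omega>) (emb (u j k) \<omega>) (g j \<omega>)) \<longlonglongrightarrow> 0"
    by blast+
  \<comment> \<open>Almost everywhere \<open>\<rho> j k\<close> is the distance from the k-th
    approximant to g j. Written through approximants in V alone, it is measurable on the whole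
    space, so the level sets of \<open>K j\<close> are measurable.\<close>
  define \<rho> where "\<rho> j k \<omega> = lim (\<lambda>l. n \<omega> (u j k \<omega> - u j l \<omega>))" for j k \<omega>
  \<comment> \<open>Off a null set some k qualifies for every j; elsewhere the value of the least
    index does not affect the limit.\<close>
  define K where "K j \<omega> = (LEAST k. \<rho> j k \<omega> < inverse (real (Suc j)))" for j \<omega>
  have \<rho>_meas: "\<rho> j k \<in> borel_measurable M" for j k
    unfolding \<rho>_def
    by (intro borel_measurable_lim_metric n_countably_valued countably_valued_comp2[OF u u])
  have K: "countably_valued M (K j)" for j
    unfolding K_def by (rule countably_valued_count_space) (use \<rho>_meas in measurable)
  have g_carr: "AE \<omega> in M. \<forall>j. g j \<omega> \<in> carr (fib \<omega>)"
    unfolding AE_all_countable using measurable_section_carr[OF g] by blast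
  have limu': "AE \<omega> in M. \<forall>j. (\<lambda>k. ndist (fib \<omega>) (emb (u j k) \<omega>) (g j \<omega>)) \<longlonglongrightarrow> 0"
    unfolding AE_all_countable using limu by blast
  show ?thesis
  proof (rule measurable_sectionI[OF f])
    show "countably_valued M (\<lambda>\<omega>. u j (K j \<omega>) \<omega>)" for j
      by (rule countably_valued_compose[OF K]) (rule u)
    show "AE \<omega> in M. (\<lambda>j. ndist (fib \<omega>) (embed (n \<omega>) (u j (K j \<omega>) \<omega>)) (f \<omega>)) \<longlonglongrightarrow> 0"
      using f g_carr lim limu' AE_space
    proof eventually_elim
      case (elim \<omega>)
      interpret seminormed s "n \<omega>" by (rule fibre) (rule elim)
      let ?d = "ndist (fib \<omega>)"
      have gc: "g j \<omega> \<in> carr (fib \<omega>)" for j using elim(2) by blast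
      have limg: "(\<lambda>k. ?d (emb (u j k) \<omega>) (g j \<omega>)) \<longlonglongrightarrow> 0" for j using elim(4) by blast
      have \<rho>: "\<rho> j k \<omega> = ?d (emb (u j k) \<omega>) (g j \<omega>)" for j k
      proof -
        have "(\<lambda>l. \<bar>n \<omega> (u j k \<omega> - u j l \<omega>) - ?d (emb (u j k) \<omega>) (g j \<omega>)\<bar>) \<longlonglongrightarrow> 0"
        proof (rule squeeze_zero[OF limg[of j]])
          fix l
          have "?d (emb (u j k) \<omega>) (emb (u j l) \<omega>)
              \<le> ?d (emb (u j k) \<omega>) (g j \<omega>) + ?d (emb (u j l) \<omega>) (g j \<omega>)"
            using ndist_triangle[OF embed_carr gc embed_carr] ndist_commute[OF embed_carr gc]
            by metis
          moreover have "?d (emb (u j k) \<omega>) (g j \<omega>)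
              \<le> ?d (emb (u j k) \<omega>) (emb (u j l) \<omega>) + ?d (emb (u j l) \<omega>) (g j \<omega>)"
            by (rule ndist_triangle[OF embed_carr embed_carr gc])
          ultimately show "\<bar>n \<omega> (u j k \<omega> - u j l \<omega>) - ?d (emb (u j k) \<omega>) (g j \<omega>)\<bar>
              \<le> ?d (emb (u j l) \<omega>) (g j \<omega>)"
            by simp
        qed simp
        then have "(\<lambda>l. n \<omega> (u j k \<omega> - u j l \<omega>)) \<longlonglongrightarrow> ?d (emb (u j k) \<omega>) (g j \<omega>)"
          by (simp add: tendsto_rabs_zero_iff LIM_zero_iff)
        then show ?thesis unfolding \<rho>_def by (rule limI)
      qed
      have near: "?d (emb (u j (K j \<omega>)) \<omega>) (g j \<omega>) < inverse (real (Suc j))" for j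
      proof -
        have "eventually (\<lambda>k. \<rho> j k \<omega> < inverse (real (Suc j))) sequentially"
          unfolding \<rho> by (rule order_tendstoD[OF limg]) simp
        then have "\<exists>k. \<rho> j k \<omega> < inverse (real (Suc j))"
          by (auto simp: eventually_sequentially)
        then have "\<rho> j (K j \<omega>) \<omega> < inverse (real (Suc j))"
          unfolding K_def by (rule LeastI_ex)
        then show ?thesis by (simp only: \<rho>)
      qed
      have "(\<lambda>j. inverse (real (Suc j)) + ?d (g j \<omega>) (f \<omega>)) \<longlonglongrightarrow> 0"
        using tendsto_add[OF LIMSEQ_inverse_real_of_nat elim(3)] by simp
      then show ?case
      proof (rule squeeze_zero)
        fix j
        show "0 \<le> ?d (embed (n \<omega>) (u j (K j \<omega>) \<omega>)) (f \<omega>)"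
          by (rule ndist_nonneg[OF embed_carr elim(1)])
        show "?d (embed (n \<omega>) (u j (K j \<omega>) \<omega>)) (f \<omega>) \<le> inverse (real (Suc j)) + ?d (g j \<omega>) (f \<omega>)"
          using ndist_triangle[OF embed_carr gc elim(1), of "u j (K j \<omega>) \<omega>" j] near[of j] by simp
      qed
    qed
  qed
qed

end

section \<open>Essential suprema and powers of extended nonnegative reals\<close>

lemma ennreal_inverse_le_iff: "inverse x \<le> inverse y \<longleftrightarrow> y \<le> (x::ennreal)"
proof (cases "x = 0 \<or> y = 0")
  case True
  then show ?thesis by (auto simp: top_unique)
next
  case False
  show ?thesis
  proof (cases "x = top \<or> y = top")
    case True
    then show ?thesis by (auto simp: top_unique)
  next
    case not_top: False
    obtain a where a: "x = ennreal a" "a > 0"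
      using False not_top by (cases x) (auto simp: less_le)
    obtain b where b: "y = ennreal b" "b > 0"
      using False not_top by (cases y) (auto simp: less_le)
    show ?thesis
      using a(2) b(2) unfolding a(1) b(1) by (simp add: inverse_ennreal)
  qed
qed

text \<open>\<open>inverse (1 + x)\<close> reverses the order and takes values in [0, 1]. It turns
  an essential infimum of unbounded functions into an essential maximum of bounded ones; with a
  further inverse inside, the order is preserved and suprema are treated alike.\<close>

lemma ennreal_inverse_one_plus_le_iff: "inverse (1 + x) \<le> inverse (1 + y) \<longleftrightarrow> y \<le> (x::ennreal)"
  unfolding ennreal_inverse_le_iff by (simp add: ennreal_add_left_cancel_le)

lemma ennreal_inverse_one_plus_le_1: "inverse (1 + x) \<le> (1::ennreal)"
  using ennreal_inverse_one_plus_le_iff[of x 0] by simp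

lemma ennreal_inverse_one_plus_inverse_le_iff:
  "inverse (1 + inverse x) \<le> inverse (1 + inverse y) \<longleftrightarrow> x \<le> (y::ennreal)"
  by (simp only: ennreal_inverse_one_plus_le_iff) (rule ennreal_inverse_le_iff)

text \<open>Exhaustion: weight by a strictly positive h of finite integral and let g lie above a
  sequence in U that maximizes the weighted integral. If some g' in U exceeded g on a set of
  positive measure, an upper bound of both in U would have a larger integral.\<close>

lemma (in sigma_finite_measure) essential_maximum:
  fixes U :: "('a \<Rightarrow> ennreal) set"
  assumes U: "U \<subseteq> borel_measurable M" "U \<noteq> {}" and le_1: "\<And>g x. g \<in> U \<Longrightarrow> g x \<le> 1"
    and directed: "\<And>g :: nat \<Rightarrow> 'a \<Rightarrow> ennreal. range g \<subseteq> U \<Longrightarrow> \<exists>u\<in>U. \<forall>i x. g i x \<le> u x"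
  obtains g where "g \<in> U" "\<And>g'. g' \<in> U \<Longrightarrow> AE x in M. g' x \<le> g x"
proof -
  obtain h where h: "h \<in> borel_measurable M" "integral\<^sup>N M h \<noteq> \<infinity>"
    and h_pos: "\<And>x. x \<in> space M \<Longrightarrow> 0 < h x \<and> h x < \<infinity>"
    using Ex_finite_integrable_function by blast
  define \<Phi> where "\<Phi> g = (\<integral>\<^sup>+ x. h x * g x \<partial>M)" for g
  obtain t :: "nat \<Rightarrow> ennreal" where t: "range t \<subseteq> \<Phi> ` U" "Sup (\<Phi> ` U) = Sup (range t)"
    using ennreal_SUP_countable_SUP[OF U(2), of \<Phi>] by blast
  have "\<forall>i. \<exists>g. g \<in> U \<and> \<Phi> g = t i"
  proof
    fix i
    have "t i \<in> \<Phi> ` U" by (rule subsetD[OF t(1) rangeI])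
    then show "\<exists>g. g \<in> U \<and> \<Phi> g = t i" by (elim imageE) auto
  qed
  from choice[OF this] obtain gs where gs: "\<forall>i. gs i \<in> U \<and> \<Phi> (gs i) = t i" ..
  then have "range gs \<subseteq> U" by blast
  from directed[OF this] obtain g where g: "g \<in> U" and gs_le: "\<And>i x. gs i x \<le> g x"
    by blast
  have \<Phi>_mono: "\<Phi> k \<le> \<Phi> l" if "\<And>x. k x \<le> l x" for k l
    unfolding \<Phi>_def by (intro nn_integral_mono mult_left_mono that) simp
  have max: "\<Phi> k \<le> \<Phi> g" if "k \<in> U" for k
  proof -
    have "\<Phi> k \<le> Sup (\<Phi> ` U)" using that by (rule SUP_upper)
    also have "\<dots> \<le> \<Phi> g"
      unfolding t(2)
    proof (rule SUP_least)
      fix i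
      have "\<Phi> (gs i) \<le> \<Phi> g" by (rule \<Phi>_mono) (rule gs_le)
      then show "t i \<le> \<Phi> g" using gs by simp
    qed
    finally show ?thesis .
  qed
  show thesis
  proof (rule that[OF g])
    fix g' assume g': "g' \<in> U"
    \<comment> \<open>The pair is presented as a sequence so that countable directedness applies to
      it.\<close>
    have "range (\<lambda>i::nat. if i = 0 then g else g') \<subseteq> U"
      using g g' by auto
    from directed[OF this] obtain u where u: "u \<in> U"
      and *: "\<And>i x. (if i = (0::nat) then g else g') x \<le> u x"
      by blast
    have gu: "g x \<le> u x" and g'u: "g' x \<le> u x" for x
      using *[of 0 x] *[of 1 x] by simp_all
    have [measurable]: "u \<in> borel_measurable M" "g \<in> borel_measurable M" "h \<in> borel_measurable M"
      using u g h U(1) by auto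
    \<comment> \<open>The bound by 1 makes the weighted integral of g finite, which allows it to be
      subtracted in \<open>ennreal\<close>.\<close>
    have "\<Phi> g \<le> integral\<^sup>N M h"
      unfolding \<Phi>_def using le_1[OF g] by (intro nn_integral_mono) (simp add: mult_left_le)
    then have fin: "\<Phi> g \<noteq> \<infinity>"
      using h(2) by (auto simp: top_unique)
    have "(\<integral>\<^sup>+ x. h x * u x - h x * g x \<partial>M) = \<Phi> u - \<Phi> g"
      unfolding \<Phi>_def
      by (rule nn_integral_diff) (use fin gu in \<open>auto simp: \<Phi>_def mult_left_mono\<close>)
    also have "\<dots> = 0"
      using max[OF u] fin by (intro diff_eq_0_ennreal) (auto simp: less_top intro: le_less_trans)
    finally have "AE x in M. h x * u x - h x * g x = 0"
      by (subst (asm) nn_integral_0_iff_AE) auto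
    then show "AE x in M. g' x \<le> g x"
      using AE_space
    proof eventually_elim
      case (elim x)
      have "h x \<noteq> 0" "h x \<noteq> top" using h_pos[OF elim(2)] by auto
      then have "u x \<le> g x"
        using ennreal_minus_eq_0[OF elim(1)] by (simp add: ennreal_mult_le_mult_iff)
      then show ?case using g'u order_trans by blast
    qed
  qed
qed

text \<open>Members of F may fail to be measurable, so suprema of countable subfamilies are not
  candidates. The supremum is found from above, as the a.e. least measurable majorant: majorants
  include the constant top and are closed under countable infima.\<close>

lemma is_lattice_sup_exists:
  assumes "sigma_finite_measure M"
  shows "\<exists>g. is_lattice_sup M F g"
proof -
  interpret sigma_finite_measure M by (rule assms)
  let ?V = "{g \<in> borel_measurable M. \<forall>f\<in>F. AE \<omega> in M. f \<omega> \<le> g \<omega>}"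
  let ?T = "\<lambda>g \<omega>. inverse (1 + g \<omega>) :: ennreal"
  obtain k where k: "k \<in> ?T ` ?V" and max: "\<And>k'. k' \<in> ?T ` ?V \<Longrightarrow> AE x in M. k' x \<le> k x"
  proof (rule essential_maximum[of "?T ` ?V"])
    have "(\<lambda>_. top) \<in> ?V" by simp
    then show "?T ` ?V \<noteq> {}" by blast
    show "?T ` ?V \<subseteq> borel_measurable M" by auto
    show "g x \<le> 1" if "g \<in> ?T ` ?V" for g x
      using that by (auto simp: ennreal_inverse_one_plus_le_1)
    show "\<exists>u\<in>?T ` ?V. \<forall>i x. ks i x \<le> u x" if "range ks \<subseteq> ?T ` ?V" for ks :: "nat \<Rightarrow> _"
    proof -
      have "\<forall>i. \<exists>g. g \<in> ?V \<and> ks i = ?T g"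
        using that by blast
      from choice[OF this] obtain gs where "\<forall>i. gs i \<in> ?V \<and> ks i = ?T (gs i)" ..
      then have gs: "\<And>i. gs i \<in> ?V" and ks: "\<And>i. ks i = ?T (gs i)" by blast+
      let ?g = "\<lambda>\<omega>. INF i. gs i \<omega>"
      have "?g \<in> ?V"
      proof (intro CollectI conjI ballI)
        show "?g \<in> borel_measurable M" using gs by (intro borel_measurable_INF) auto
        fix f assume "f \<in> F"
        then have "AE \<omega> in M. \<forall>i. f \<omega> \<le> gs i \<omega>"
          unfolding AE_all_countable using gs by blast
        then show "AE \<omega> in M. f \<omega> \<le> ?g \<omega>"
          by eventually_elim (simp add: le_INF_iff)
      qed
      moreover have "ks i x \<le> ?T ?g x" for i x
        unfolding ks ennreal_inverse_one_plus_le_iff by (rule INF_lower) simp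
      ultimately show ?thesis by (intro bexI[of _ "?T ?g"] allI image_eqI[OF refl]) blast+
    qed
  qed (rule that)
  from k obtain g where g: "g \<in> ?V" "k = ?T g" by blast
  have "AE \<omega> in M. g \<omega> \<le> g' \<omega>" if "g' \<in> ?V" for g'
    using max[of "?T g'"] that unfolding g(2) ennreal_inverse_one_plus_le_iff by blast
  with g(1) have "is_lattice_sup M F g"
    unfolding is_lattice_sup_def by blast
  then show ?thesis by (intro exI)
qed

lemma is_lattice_sup_lattice_sup:
  "sigma_finite_measure M \<Longrightarrow> is_lattice_sup M F (lattice_sup M F)"
  unfolding lattice_sup_def by (rule someI_ex[OF is_lattice_sup_exists])

text \<open>The maximum is taken over sequences of indices. Countably many sequences are merged into
  one by \<open>prod_decode\<close>, which gives the directedness, and a single index v is compared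
  through the constant sequence.\<close>

lemma (in sigma_finite_measure) countable_essential_supremum:
  fixes \<phi> :: "'v \<Rightarrow> 'a \<Rightarrow> ennreal"
  assumes \<phi>: "\<And>v. \<phi> v \<in> borel_measurable M"
  obtains c :: "nat \<Rightarrow> 'v" where "\<And>v. AE x in M. \<phi> v x \<le> (SUP i. \<phi> (c i) x)"
proof -
  let ?S = "\<lambda>(c :: nat \<Rightarrow> 'v) x. SUP i. \<phi> (c i) x"
  let ?T = "\<lambda>c x. inverse (1 + inverse (?S c x))"
  obtain k where k: "k \<in> range ?T" and max: "\<And>k'. k' \<in> range ?T \<Longrightarrow> AE x in M. k' x \<le> k x"
  proof (rule essential_maximum[of "range ?T"])
    show "range ?T \<noteq> {}" by blast
    show "range ?T \<subseteq> borel_measurable M" using \<phi> by auto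
    show "g x \<le> 1" if "g \<in> range ?T" for g x
      using that by (auto simp: ennreal_inverse_one_plus_le_1)
    show "\<exists>u\<in>range ?T. \<forall>i x. ks i x \<le> u x" if "range ks \<subseteq> range ?T" for ks :: "nat \<Rightarrow> _"
    proof -
      have "\<forall>i. \<exists>c. ks i = ?T c"
        using that by blast
      from choice[OF this] obtain cs where cs: "\<forall>i. ks i = ?T (cs i)" ..
      let ?c = "\<lambda>m. cs (fst (prod_decode m)) (snd (prod_decode m))"
      have "?S (cs i) x \<le> ?S ?c x" for i x
      proof (rule SUP_least)
        fix j
        show "\<phi> (cs i j) x \<le> ?S ?c x"
          by (rule SUP_upper2[of "prod_encode (i, j)"]) simp_all
      qed
      then have "ks i x \<le> ?T ?c x" for i x
        unfolding cs[rule_format] ennreal_inverse_one_plus_inverse_le_iff .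
      then show ?thesis by (intro bexI[of _ "?T ?c"] allI rangeI)
    qed
  qed (rule that)
  from k obtain c where c: "k = ?T c" by blast
  show thesis
  proof (rule that)
    fix v
    show "AE x in M. \<phi> v x \<le> ?S c x"
      using max[OF rangeI[of ?T "\<lambda>_. v"]]
      unfolding c ennreal_inverse_one_plus_inverse_le_iff by simp
  qed
qed

section \<open>Powers of extended nonnegative reals\<close>

lemma enn_powr_ennreal: "0 \<le> x \<Longrightarrow> enn_powr (ennreal x) a = ennreal (x powr a)"
  unfolding enn_powr_def by simp

lemma enn_powr_top: "enn_powr top a = top"
  unfolding enn_powr_def by simp

lemma enn_powr_mono:
  assumes "x \<le> y" "0 \<le> a"
  shows "enn_powr x a \<le> enn_powr y a"
proof (cases "y = top")
  case False
  then have "enn2real x \<le> enn2real y"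
    using assms(1) by (intro enn2real_mono) (auto simp: less_top)
  moreover have "x \<noteq> top" using False assms(1) by (auto simp: top_unique)
  ultimately show ?thesis
    using False assms(2) unfolding enn_powr_def by (simp add: powr_mono2)
qed (simp add: enn_powr_top)

lemma enn_powr_powr:
  assumes "a > 0" "b > 0"
  shows "enn_powr (enn_powr x a) b = enn_powr x (a * b)"
  by (cases x) (simp_all add: enn_powr_ennreal enn_powr_top powr_powr)

lemma enn_powr_one: "enn_powr x 1 = x"
  by (cases x) (simp_all add: enn_powr_ennreal enn_powr_top)

lemma enn_powr_eq_0_iff: "enn_powr x a = 0 \<longleftrightarrow> x = 0"
  by (cases x) (auto simp: enn_powr_ennreal enn_powr_top)

lemma enn_powr_mult:
  assumes "a > 0"
  shows "enn_powr (x * y) a = enn_powr x a * enn_powr y a"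
\<comment> \<open>Zero factors come first because the other factor may be top, and 0 * top =
  0.\<close>
proof (cases "x = 0 \<or> y = 0")
  case True
  then show ?thesis by (auto simp: enn_powr_def)
next
  case False
  then show ?thesis
    by (cases x; cases y)
      (auto simp: enn_powr_ennreal enn_powr_top ennreal_mult_eq_top_iff enn_powr_eq_0_iff
         ennreal_mult[symmetric] powr_mult ennreal_mult_top ennreal_top_mult)
qed

text \<open>Monotonicity under the inverse exponent 1 / a replaces an argument by continuity of the
  power at the supremum.\<close>

lemma enn_powr_SUP_le:
  assumes "a > 0" and "\<And>i. enn_powr (x i) a \<le> z" and "y \<le> (SUP i. x i)"
  shows "enn_powr y a \<le> z"
proof -
  have "x i \<le> enn_powr z (1 / a)" for i
    using enn_powr_mono[OF assms(2)[of i], of "1 / a"] assms(1)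
    by (simp add: enn_powr_powr enn_powr_one)
  then have "y \<le> enn_powr z (1 / a)"
    using assms(3) by (meson SUP_least order_trans)
  then show ?thesis
    using enn_powr_mono[of y "enn_powr z (1 / a)" a] assms(1)
    by (simp add: enn_powr_powr enn_powr_one)
qed

lemma borel_measurable_enn_powr [measurable (raw)]:
  "f \<in> borel_measurable M \<Longrightarrow> (\<lambda>x. enn_powr (f x) a) \<in> borel_measurable M"
proof -
  assume f: "f \<in> borel_measurable M"
  have "{x \<in> space M. f x = \<infinity>} = f -` {\<infinity>} \<inter> space M" by auto
  also have "\<dots> \<in> sets M" by (rule measurable_sets[OF f]) simp
  finally show ?thesis
    using f unfolding enn_powr_def by (intro measurable_If measurable_const) auto
qed

section \<open>The spaces of p-integrable sections\<close>

context banach_family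
begin

text \<open>A real coefficient may take uncountably many values. Rounding it down to multiples of 1
  / (j + 1) makes it countably valued, with an error that tends to 0 uniformly in \<omega>.\<close>

lemma section_scaled:
  assumes a: "a \<in> borel_measurable M" and u: "countably_valued M u"
  shows "measurable_section M s n (emb (\<lambda>\<omega>. s (of_real (a \<omega>)) (u \<omega>)))"
proof (rule measurable_sectionI)
  define b where "b j \<omega> = real_of_int \<lfloor>real (Suc j) * a \<omega>\<rfloor> / real (Suc j)" for j \<omega>
  have b_close: "\<bar>b j \<omega> - a \<omega>\<bar> \<le> inverse (real (Suc j))" for j \<omega>
  proof -
    let ?y = "real (Suc j) * a \<omega>"
    have "b j \<omega> - a \<omega> = (of_int \<lfloor>?y\<rfloor> - ?y) * inverse (real (Suc j))"
      unfolding b_def by (simp add: field_simps del: of_nat_Suc)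
    then have "\<bar>b j \<omega> - a \<omega>\<bar> = \<bar>of_int \<lfloor>?y\<rfloor> - ?y\<bar> * inverse (real (Suc j))"
      by (simp add: abs_mult)
    also have "\<dots> \<le> 1 * inverse (real (Suc j))"
      by (intro mult_right_mono) (linarith, simp)
    finally show ?thesis by simp
  qed
  show "AE \<omega> in M. emb (\<lambda>\<omega>. s (of_real (a \<omega>)) (u \<omega>)) \<omega> \<in> carr (fib \<omega>)"
    by (rule AE_I2) (rule seminormed.embed_carr[OF fibre])
  show "countably_valued M (\<lambda>\<omega>. s (of_real (b j \<omega>)) (u \<omega>))" for j
  proof -
    have "(\<lambda>\<omega>. \<lfloor>real (Suc j) * a \<omega>\<rfloor>) \<in> measurable M (count_space UNIV)"
      using a by measurable
    then have "countably_valued M (\<lambda>\<omega>. \<lfloor>real (Suc j) * a \<omega>\<rfloor>)"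
      by (rule countably_valued_count_space)
    from countably_valued_comp2[OF this u, of "\<lambda>z v. s (of_real (real_of_int z / real (Suc j))) v"]
    show ?thesis unfolding b_def .
  qed
  show "AE \<omega> in M. (\<lambda>j. ndist (fib \<omega>) (emb (\<lambda>\<omega>. s (of_real (b j \<omega>)) (u \<omega>)) \<omega>)
      (emb (\<lambda>\<omega>. s (of_real (a \<omega>)) (u \<omega>)) \<omega>)) \<longlonglongrightarrow> 0"
  proof (rule AE_I2)
    fix \<omega> assume "\<omega> \<in> space M"
    then interpret seminormed s "n \<omega>" by (rule fibre)
    have "n \<omega> (s (of_real (b j \<omega>)) (u \<omega>) - s (of_real (a \<omega>)) (u \<omega>)) = \<bar>b j \<omega> - a \<omega>\<bar> * n \<omega> (u \<omega>)" for j
    proof -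
      have "s (of_real (b j \<omega>)) (u \<omega>) - s (of_real (a \<omega>)) (u \<omega>)
          = s (of_real (b j \<omega> - a \<omega>)) (u \<omega>)"
        by (simp add: scale_left_diff_distrib)
      then show ?thesis by (simp only: n_scale norm_of_real)
    qed
    moreover have "(\<lambda>j. \<bar>b j \<omega> - a \<omega>\<bar> * n \<omega> (u \<omega>)) \<longlonglongrightarrow> 0"
    proof (rule squeeze_zero)
      show "(\<lambda>j. inverse (real (Suc j)) * n \<omega> (u \<omega>)) \<longlonglongrightarrow> 0"
        using tendsto_mult_right[OF LIMSEQ_inverse_real_of_nat, of "n \<omega> (u \<omega>)"] by simp
      show "0 \<le> \<bar>b j \<omega> - a \<omega>\<bar> * n \<omega> (u \<omega>)" for j
        by (intro mult_nonneg_nonneg abs_ge_zero n_nonneg)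
      show "\<bar>b j \<omega> - a \<omega>\<bar> * n \<omega> (u \<omega>) \<le> inverse (real (Suc j)) * n \<omega> (u \<omega>)" for j
        by (intro mult_right_mono b_close n_nonneg)
    qed
    ultimately show "(\<lambda>j. ndist (fib \<omega>) (emb (\<lambda>\<omega>. s (of_real (b j \<omega>)) (u \<omega>)) \<omega>)
      (emb (\<lambda>\<omega>. s (of_real (a \<omega>)) (u \<omega>)) \<omega>)) \<longlonglongrightarrow> 0"
      by simp
  qed
qed

section \<open>Classes of sections and the operations on them\<close>

abbreviation scls :: "('o \<Rightarrow> (nat \<Rightarrow> 'v) set) \<Rightarrow> ('o \<Rightarrow> (nat \<Rightarrow> 'v) set) set" where
  "scls f \<equiv> section_rel M s n `` {f}"

lemma section_rel_iff:
  "(f, g) \<in> section_rel M s n \<longleftrightarrow>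
    measurable_section M s n f \<and> measurable_section M s n g \<and> (AE \<omega> in M. f \<omega> = g \<omega>)"
  unfolding section_rel_def by simp

lemma equiv_section_rel: "equiv (Collect (measurable_section M s n)) (section_rel M s n)"
proof (rule equivI)
  show "section_rel M s n \<subseteq> Collect (measurable_section M s n) \<times> Collect (measurable_section M s n)"
    unfolding section_rel_def by auto
  show "refl_on (Collect (measurable_section M s n)) (section_rel M s n)"
    by (rule refl_onI) (simp add: section_rel_iff)
  show "sym (section_rel M s n)"
  proof (rule symI)
    fix f g assume fg: "(f, g) \<in> section_rel M s n"
    then have "AE \<omega> in M. f \<omega> = g \<omega>" unfolding section_rel_iff by blast
    then have "AE \<omega> in M. g \<omega> = f \<omega>" by eventually_elim simp
    with fg show "(g, f) \<in> section_rel M s n" unfolding section_rel_iff by blast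
  qed
  show "trans (section_rel M s n)"
  proof (rule transI)
    fix f g h assume fgh: "(f, g) \<in> section_rel M s n" "(g, h) \<in> section_rel M s n"
    then have "AE \<omega> in M. f \<omega> = g \<omega>" "AE \<omega> in M. g \<omega> = h \<omega>" unfolding section_rel_iff by blast+
    then have "AE \<omega> in M. f \<omega> = h \<omega>" by eventually_elim simp
    with fgh show "(f, h) \<in> section_rel M s n" unfolding section_rel_iff by blast
  qed
qed

lemma scls_eq:
  "measurable_section M s n f \<Longrightarrow> AE \<omega> in M. f \<omega> = g \<omega> \<Longrightarrow> scls g = scls f"
  by (rule equiv_class_eq[OF equiv_section_rel, symmetric])
    (auto simp: section_rel_iff intro: section_AE_cong)

lemma scls_self: "measurable_section M s n f \<Longrightarrow> f \<in> scls f"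
  by (simp add: section_rel_iff)

lemma in_scls:
  "g \<in> scls f \<longleftrightarrow> measurable_section M s n f \<and> measurable_section M s n g \<and> (AE \<omega> in M. f \<omega> = g \<omega>)"
  by (simp add: section_rel_iff)

lemma section_int_cong: "AE \<omega> in M. f \<omega> = g \<omega> \<Longrightarrow> section_int M s n r f = section_int M s n r g"
  unfolding section_int_def by (rule nn_integral_cong_AE) (erule AE_mp, rule AE_I2, simp)

lemma in_carr_Lp:
  "F \<in> carr (direct_integral_Lp M s n r) \<longleftrightarrow>
    (\<exists>f. F = scls f \<and> measurable_section M s n f \<and> section_int M s n r f < \<infinity>)"
proof
  assume F: "F \<in> carr (direct_integral_Lp M s n r)"
  then obtain f where f: "measurable_section M s n f" "F = scls f"
    unfolding direct_integral_Lp_def direct_integral_def by (auto elim!: quotientE)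
  moreover have "f \<in> F" using f scls_self by blast
  ultimately show "\<exists>f. F = scls f \<and> measurable_section M s n f \<and> section_int M s n r f < \<infinity>"
    using F unfolding direct_integral_Lp_def by auto
next
  assume "\<exists>f. F = scls f \<and> measurable_section M s n f \<and> section_int M s n r f < \<infinity>"
  then obtain f where f: "F = scls f" "measurable_section M s n f" "section_int M s n r f < \<infinity>"
    by blast
  have "F \<in> direct_integral M s n"
    unfolding direct_integral_def f(1) by (rule quotientI) (simp add: f(2))
  moreover have "section_int M s n r g < \<infinity>" if "g \<in> F" for g
    using that f(3) section_int_cong[of f g r] unfolding f(1) in_scls by simp
  ultimately show "F \<in> carr (direct_integral_Lp M s n r)"
    unfolding direct_integral_Lp_def by simp
qed

lemma nrm_Lp:
  assumes f: "measurable_section M s n f"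
  shows "nrm (direct_integral_Lp M s n r) (scls f) = enn2real (section_int M s n r f) powr (1 / r)"
proof -
  have "(\<lambda>g. enn2real (section_int M s n r g) powr (1 / r)) ` scls f =
      (\<lambda>g. enn2real (section_int M s n r f) powr (1 / r)) ` scls f"
  proof (rule image_cong[OF refl])
    fix g assume "g \<in> scls f"
    then have "section_int M s n r f = section_int M s n r g"
      unfolding in_scls by (intro section_int_cong) blast
    then show "enn2real (section_int M s n r g) powr (1 / r) =
      enn2real (section_int M s n r f) powr (1 / r)" by simp
  qed
  also have "\<dots> = {enn2real (section_int M s n r f) powr (1 / r)}"
    using scls_self[OF f] by blast
  finally show ?thesis unfolding direct_integral_Lp_def by simp
qed

lemma scls_nonempty: "measurable_section M s n f \<Longrightarrow> scls f \<noteq> {}"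
  using scls_self by blast

lemma add_Lp:
  assumes f: "measurable_section M s n f" and g: "measurable_section M s n g"
  shows "add (direct_integral_Lp M s n r) (scls f) (scls g) = scls (\<lambda>\<omega>. add (fib \<omega>) (f \<omega>) (g \<omega>))"
proof -
  have "scls (\<lambda>\<omega>. add (fib \<omega>) (f' \<omega>) (g' \<omega>)) = scls (\<lambda>\<omega>. add (fib \<omega>) (f \<omega>) (g \<omega>))"
    if "f' \<in> scls f" "g' \<in> scls g" for f' g'
  proof (rule scls_eq[OF section_add[OF f g]])
    have "AE \<omega> in M. f \<omega> = f' \<omega>" "AE \<omega> in M. g \<omega> = g' \<omega>"
      using that unfolding in_scls by blast+
    then show "AE \<omega> in M. add (fib \<omega>) (f \<omega>) (g \<omega>) = add (fib \<omega>) (f' \<omega>) (g' \<omega>)"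
      by eventually_elim simp
  qed
  then have "(\<Union>f'\<in>scls f. \<Union>g'\<in>scls g. scls (\<lambda>\<omega>. add (fib \<omega>) (f' \<omega>) (g' \<omega>))) =
      scls (\<lambda>\<omega>. add (fib \<omega>) (f \<omega>) (g \<omega>))"
    by (rule SUP_eq_const[OF scls_nonempty[OF f] SUP_eq_const[OF scls_nonempty[OF g]]])
  then show ?thesis unfolding direct_integral_Lp_def by simp
qed

lemma scl_Lp:
  assumes f: "measurable_section M s n f"
  shows "scl (direct_integral_Lp M s n r) c (scls f) = scls (\<lambda>\<omega>. scl (fib \<omega>) c (f \<omega>))"
proof -
  have "scls (\<lambda>\<omega>. scl (fib \<omega>) c (f' \<omega>)) = scls (\<lambda>\<omega>. scl (fib \<omega>) c (f \<omega>))"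
    if "f' \<in> scls f" for f'
  proof (rule scls_eq[OF section_scl[OF f]])
    have "AE \<omega> in M. f \<omega> = f' \<omega>"
      using that unfolding in_scls by blast
    then show "AE \<omega> in M. scl (fib \<omega>) c (f \<omega>) = scl (fib \<omega>) c (f' \<omega>)"
      by eventually_elim simp
  qed
  then have "(\<Union>f'\<in>scls f. scls (\<lambda>\<omega>. scl (fib \<omega>) c (f' \<omega>))) = scls (\<lambda>\<omega>. scl (fib \<omega>) c (f \<omega>))"
    by (rule SUP_eq_const[OF scls_nonempty[OF f]])
  then show ?thesis unfolding direct_integral_Lp_def by simp
qed

end

section \<open>Operator families\<close>

text \<open>Take L with a strictly positive density of finite integral. A set is L-null only if the
  density vanishes a.e. on it, hence only if it is M-null.\<close>

lemma finite_measure_same_null_sets: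
  assumes "sigma_finite_measure M"
  obtains L where "finite_measure L" "sets L = sets M" "absolutely_continuous L M"
proof -
  obtain h where h: "h \<in> borel_measurable M" "integral\<^sup>N M h \<noteq> \<infinity>"
    and h_pos: "\<And>x. x \<in> space M \<Longrightarrow> 0 < h x \<and> h x < \<infinity>"
    using sigma_finite_measure.Ex_finite_integrable_function[OF assms] by blast
  show thesis
  proof (rule that[of "density M h"])
    have "emeasure (density M h) (space M) = integral\<^sup>N M h"
      using h(1) by (subst emeasure_density) (auto intro!: nn_integral_cong)
    then show "finite_measure (density M h)"
      using h(2) by (intro finite_measureI) simp
    show "sets (density M h) = sets M" by simp
    show "absolutely_continuous (density M h) M"
      unfolding absolutely_continuous_def
    proof
      fix A assume "A \<in> null_sets (density M h)"
      then have A: "A \<in> sets M" and ae: "AE x in M. x \<in> A \<longrightarrow> h x = 0"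
        using h(1) by (auto simp: null_sets_density_iff)
      from ae have "AE x in M. x \<notin> A"
        by (rule AE_mp) (rule AE_I2, use h_pos in fastforce)
      with A show "A \<in> null_sets M" by (simp add: AE_iff_null_sets)
    qed
  qed
qed

locale operator_family =
  fixes M N L :: "'o measure"
    and s :: "'k::real_normed_field \<Rightarrow> 'v::ab_group_add \<Rightarrow> 'v" and n :: "'o \<Rightarrow> 'v \<Rightarrow> real"
    and t :: "'k \<Rightarrow> 'w::ab_group_add \<Rightarrow> 'w" and l :: "'o \<Rightarrow> 'w \<Rightarrow> real"
    and Q :: "'o \<Rightarrow> (nat \<Rightarrow> 'v) set \<Rightarrow> (nat \<Rightarrow> 'w) set"
  assumes sigma_finite: "sigma_finite_measure M"
    and sets_N: "sets N = sets M"
    and abs_cont: "absolutely_continuous M N"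
    and family_B: "measurable_banach_family M s n"
    and family_D: "measurable_banach_family N t l"
    and family_Q: "measurable_operator_family M s n N t l Q"
    and finite_L: "finite_measure L"
    and sets_L: "sets L = sets M"
    and abs_cont_L: "absolutely_continuous L M"
begin

sublocale B: banach_family M L s n
  by (rule banach_family.intro[OF family_B finite_L sets_L abs_cont_L])

text \<open>L-null sets are M-null, hence N-null, so one finite measure serves both
  families.\<close>

sublocale D: banach_family N L t l
  using abs_cont_L abs_cont
  by (intro banach_family.intro[OF family_D finite_L])
    (auto simp: absolutely_continuous_def sets_L sets_N)

lemma space_N: "space N = space M"
  by (rule sets_eq_imp_space_eq[OF sets_N])

lemma AE_N: "AE \<omega> in M. P \<omega> \<Longrightarrow> AE \<omega> in N. P \<omega>"
  by (rule absolutely_continuous_AE[OF sets_N abs_cont])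

abbreviation J :: "'o \<Rightarrow> ennreal" where "J \<equiv> RN_deriv M N"

abbreviation RN :: "'o \<Rightarrow> ennreal" where "RN \<equiv> random_norm M s n t l Q"

text \<open>N has density J with respect to M. This is how facts about the fibres of D, known only
  N-a.e., are read under M: they hold a.e. where J > 0, and nothing is said where J = 0.\<close>

lemma AE_N_iff: "(AE \<omega> in N. P \<omega>) \<longleftrightarrow> (AE \<omega> in M. 0 < J \<omega> \<longrightarrow> P \<omega>)"
proof -
  have "density M J = N"
    by (rule sigma_finite_measure.density_RN_deriv[OF sigma_finite abs_cont sets_N])
  then have "(AE \<omega> in N. P \<omega>) \<longleftrightarrow> (AE \<omega> in density M J. P \<omega>)" by (simp only:)
  also have "\<dots> \<longleftrightarrow> (AE \<omega> in M. 0 < J \<omega> \<longrightarrow> P \<omega>)"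
    by (rule AE_density) (rule borel_measurable_RN_deriv)
  finally show ?thesis .
qed

lemma nn_integral_N:
  "f \<in> borel_measurable M \<Longrightarrow> integral\<^sup>N N f = (\<integral>\<^sup>+ \<omega>. J \<omega> * f \<omega> \<partial>M)"
  by (rule sigma_finite_measure.RN_deriv_nn_integral[OF sigma_finite abs_cont sets_N])

lemma borel_measurable_N: "f \<in> borel_measurable N \<longleftrightarrow> f \<in> borel_measurable M"
  using measurable_cong_sets[OF sets_N refl] by blast

lemma countably_valued_N: "countably_valued N u \<longleftrightarrow> countably_valued M u"
  unfolding countably_valued_def space_N sets_N ..

lemma Q_bounded_operator: "AE \<omega> in M. bounded_operator (B.fib \<omega>) (D.fib \<omega>) (Q \<omega>)"
  using family_Q unfolding measurable_operator_family_def by blast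

context
  fixes \<omega>
  assumes \<omega>: "\<omega> \<in> space M" and Q\<omega>: "bounded_operator (B.fib \<omega>) (D.fib \<omega>) (Q \<omega>)"
begin

interpretation Bw: seminormed s "n \<omega>"
  by (rule B.fibre) (rule \<omega>)

interpretation Dw: seminormed t "l \<omega>"
  by (rule D.fibre) (simp add: space_N \<omega>)

lemma Q_carr: "x \<in> carr (B.fib \<omega>) \<Longrightarrow> Q \<omega> x \<in> carr (D.fib \<omega>)"
  and Q_add: "x \<in> carr (B.fib \<omega>) \<Longrightarrow> y \<in> carr (B.fib \<omega>) \<Longrightarrow>
    Q \<omega> (add (B.fib \<omega>) x y) = add (D.fib \<omega>) (Q \<omega> x) (Q \<omega> y)"
  and Q_scl: "x \<in> carr (B.fib \<omega>) \<Longrightarrow> Q \<omega> (scl (B.fib \<omega>) c x) = scl (D.fib \<omega>) c (Q \<omega> x)"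
  using Q\<omega> unfolding bounded_operator_def by blast+

lemma Q_bound: "\<exists>C. \<forall>x\<in>carr (B.fib \<omega>). nrm (D.fib \<omega>) (Q \<omega> x) \<le> C * nrm (B.fib \<omega>) x"
  using Q\<omega> unfolding bounded_operator_def by blast

text \<open>At vectors of norm 0 the convention sets the quotient to 0; the random norm still
  controls Q there because a bounded operator sends such vectors to norm 0.\<close>

lemma Q_null:
  assumes x: "x \<in> carr (B.fib \<omega>)" "nrm (B.fib \<omega>) x = 0"
  shows "nrm (D.fib \<omega>) (Q \<omega> x) = 0"
  using Q_bound x Dw.nrm_nonneg[OF Q_carr[OF x(1)] Q_carr[OF x(1)]]
  by (metis mult_zero_right order_antisym)

lemma Q_tendsto:
  assumes x: "\<And>k::nat. x k \<in> carr (B.fib \<omega>)" and y: "y \<in> carr (B.fib \<omega>)"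
    and lim: "(\<lambda>k. ndist (B.fib \<omega>) (x k) y) \<longlonglongrightarrow> 0"
  shows "(\<lambda>k. ndist (D.fib \<omega>) (Q \<omega> (x k)) (Q \<omega> y)) \<longlonglongrightarrow> 0"
proof -
  obtain C where C: "\<forall>x\<in>carr (B.fib \<omega>). nrm (D.fib \<omega>) (Q \<omega> x) \<le> C * nrm (B.fib \<omega>) x"
    using Q_bound by blast
  have y': "scl (B.fib \<omega>) (- 1) y \<in> carr (B.fib \<omega>)" by (rule Bw.scl_carr[OF y y])
  show ?thesis
  proof (rule squeeze_zero)
    show "(\<lambda>k. C * ndist (B.fib \<omega>) (x k) y) \<longlonglongrightarrow> 0"
      using tendsto_mult_left[OF lim, of C] by simp
    show "0 \<le> ndist (D.fib \<omega>) (Q \<omega> (x k)) (Q \<omega> y)" for k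
      by (rule Dw.ndist_nonneg[OF Q_carr[OF x] Q_carr[OF y]])
    show "ndist (D.fib \<omega>) (Q \<omega> (x k)) (Q \<omega> y) \<le> C * ndist (B.fib \<omega>) (x k) y" for k
      using C[rule_format, OF Bw.add_carr[OF x[of k] y']]
      unfolding ndist_def Q_add[OF x y'] Q_scl[OF y] .
  qed
qed

end

text \<open>Measurability of Q is given for constant vectors only. A countably valued u is constant
  on each piece of a countable partition, and the images are pasted.\<close>

lemma section_Q_emb:
  assumes u: "countably_valued M u"
  shows "measurable_section N t l (\<lambda>\<omega>. Q \<omega> (B.emb u \<omega>))"
proof -
  obtain I :: "'o \<Rightarrow> nat" and c where I: "countably_valued M I"
    and c: "\<And>\<omega>. \<omega> \<in> space M \<Longrightarrow> u \<omega> = c (I \<omega>)"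
    by (rule countably_valued_nat[OF u]) (rule that)
  have "measurable_section N t l (\<lambda>\<omega>. Q \<omega> (embed (n \<omega>) (c (I \<omega>))))"
    using family_Q I unfolding measurable_operator_family_def
    by (intro D.section_paste[of I "\<lambda>i \<omega>. Q \<omega> (embed (n \<omega>) (c i))"])
      (simp_all add: countably_valued_N)
  then show ?thesis
    by (rule D.section_AE_cong) (rule AE_I2, simp add: c space_N)
qed

text \<open>Q(\<omega>) is continuous, so the images of the approximants converge to the image of f.
  These images are in general not embedded vectors of W, so the conclusion needs closure under
  limits of measurable sections.\<close>

lemma section_Q:
  assumes f: "measurable_section M s n f"
  shows "measurable_section N t l (\<lambda>\<omega>. Q \<omega> (f \<omega>))"
proof -
  obtain u where u: "\<And>k::nat. countably_valued M (u k)"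
    and lim: "AE \<omega> in M. (\<lambda>k. ndist (B.fib \<omega>) (B.emb (u k) \<omega>) (f \<omega>)) \<longlonglongrightarrow> 0"
    by (rule B.measurable_sectionE[OF f]) (rule that)
  show ?thesis
  proof (rule D.section_limit)
    show "measurable_section N t l (\<lambda>\<omega>. Q \<omega> (B.emb (u k) \<omega>))" for k
      by (rule section_Q_emb[OF u])
    have "AE \<omega> in M. Q \<omega> (f \<omega>) \<in> carr (D.fib \<omega>)"
      using AE_space Q_bounded_operator B.measurable_section_carr[OF f]
      by eventually_elim (rule Q_carr)
    then show "AE \<omega> in N. Q \<omega> (f \<omega>) \<in> carr (D.fib \<omega>)" by (rule AE_N)
    have "AE \<omega> in M. (\<lambda>k. ndist (D.fib \<omega>) (Q \<omega> (B.emb (u k) \<omega>)) (Q \<omega> (f \<omega>))) \<longlonglongrightarrow> 0"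
      using AE_space Q_bounded_operator B.measurable_section_carr[OF f] lim
    proof eventually_elim
      case (elim \<omega>)
      show ?case
        by (rule Q_tendsto[OF elim(1,2) _ elim(3,4)])
          (rule seminormed.embed_carr[OF B.fibre[OF elim(1)]])
    qed
    then show "AE \<omega> in N. (\<lambda>k. ndist (D.fib \<omega>) (Q \<omega> (B.emb (u k) \<omega>)) (Q \<omega> (f \<omega>))) \<longlonglongrightarrow> 0"
      by (rule AE_N)
  qed
qed

section \<open>Pointwise domination by the random norm\<close>

lemma RN_lattice_sup: "is_lattice_sup M (range (\<lambda>v \<omega>. ennreal
       (nrm (D.fib \<omega>) (Q \<omega> (embed (n \<omega>) v)) / nrm (B.fib \<omega>) (embed (n \<omega>) v)))) RN"
  unfolding random_norm_def by (rule is_lattice_sup_lattice_sup[OF sigma_finite])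

lemma RN_measurable: "RN \<in> borel_measurable M"
  using RN_lattice_sup unfolding is_lattice_sup_def by blast

lemma RN_bound_emb:
  "AE \<omega> in M. ennreal (nrm (D.fib \<omega>) (Q \<omega> (embed (n \<omega>) v))) \<le> RN \<omega> * ennreal (n \<omega> v)"
proof -
  have "AE \<omega> in M. ennreal (nrm (D.fib \<omega>) (Q \<omega> (embed (n \<omega>) v)) / nrm (B.fib \<omega>) (embed (n \<omega>) v)) \<le> RN \<omega>"
    using RN_lattice_sup[unfolded is_lattice_sup_def, THEN conjunct2, THEN conjunct1, THEN bspec,
        OF rangeI[of _ v]] .
  with AE_space Q_bounded_operator show ?thesis
  proof eventually_elim
    case (elim \<omega>)
    interpret Bw: seminormed s "n \<omega>" by (rule B.fibre) (rule elim)
    let ?y = "nrm (D.fib \<omega>) (Q \<omega> (embed (n \<omega>) v))"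
    show ?case
    proof (cases "n \<omega> v = 0")
      case True
      then have "?y = 0"
        by (intro Q_null[OF elim(1,2) Bw.embed_carr]) simp
      then show ?thesis by simp
    next
      case False
      then have pos: "n \<omega> v > 0" using Bw.n_nonneg[of v] by simp
      have "ennreal ?y = ennreal (?y / n \<omega> v) * ennreal (n \<omega> v)"
        using pos by (simp add: ennreal_mult''[symmetric])
      also have "\<dots> \<le> RN \<omega> * ennreal (n \<omega> v)"
        using elim(3) by (intro mult_right_mono) simp_all
      finally show ?thesis .
    qed
  qed
qed

text \<open>Each vector v has its own exceptional null set, but the approximants of f take only
  countably many values altogether. Off the union of these null sets the estimate holds along the
  whole sequence and passes to the limit.\<close>

lemma RN_bound:
  assumes f: "measurable_section M s n f"
  shows "AE \<omega> in M. ennreal (nrm (D.fib \<omega>) (Q \<omega> (f \<omega>))) \<le> RN \<omega> * ennreal (nrm (B.fib \<omega>) (f \<omega>))"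
proof -
  obtain u where u: "\<And>k::nat. countably_valued M (u k)"
    and lim: "AE \<omega> in M. (\<lambda>k. ndist (B.fib \<omega>) (B.emb (u k) \<omega>) (f \<omega>)) \<longlonglongrightarrow> 0"
    by (rule B.measurable_sectionE[OF f]) (rule that)
  have "AE \<omega> in M. ennreal (nrm (D.fib \<omega>) (Q \<omega> (B.emb (u k) \<omega>))) \<le> RN \<omega> * ennreal (n \<omega> (u k \<omega>))" for k
  proof -
    obtain I :: "'o \<Rightarrow> nat" and c where I: "countably_valued M I"
      and c: "\<And>\<omega>. \<omega> \<in> space M \<Longrightarrow> u k \<omega> = c (I \<omega>)"
      by (rule countably_valued_nat[OF u]) (rule that)
    have "AE \<omega> in M. \<forall>i. ennreal (nrm (D.fib \<omega>) (Q \<omega> (embed (n \<omega>) (c i)))) \<le> RN \<omega> * ennreal (n \<omega> (c i))"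
      unfolding AE_all_countable using RN_bound_emb by blast
    with AE_space show ?thesis
      by eventually_elim (simp add: c)
  qed
  then have "AE \<omega> in M. \<forall>k. ennreal (nrm (D.fib \<omega>) (Q \<omega> (B.emb (u k) \<omega>))) \<le> RN \<omega> * ennreal (n \<omega> (u k \<omega>))"
    unfolding AE_all_countable by blast
  with AE_space Q_bounded_operator B.measurable_section_carr[OF f] lim show ?thesis
  proof eventually_elim
    case (elim \<omega>)
    interpret Bw: seminormed s "n \<omega>" by (rule B.fibre) (rule elim)
    interpret Dw: seminormed t "l \<omega>" by (rule D.fibre) (simp add: space_N elim)
    note carrs = Q_carr[OF elim(1,2)]
    let ?x = "nrm (B.fib \<omega>) (f \<omega>)" and ?y = "nrm (D.fib \<omega>) (Q \<omega> (f \<omega>))"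
    have x_nonneg: "0 \<le> ?x" by (rule Bw.nrm_nonneg[OF elim(3,3)])
    show ?case
    \<comment> \<open>A zero norm is treated first: if the random norm is top, the right-hand side
      is top * 0 = 0 rather than top.\<close>
    proof (cases "?x = 0")
      case True
      then have "?y = 0" by (rule Q_null[OF elim(1-3)])
      then show ?thesis by simp
    next
      case x: False
      show ?thesis
      proof (cases "RN \<omega>")
        case (real a)
        have "(\<lambda>k. \<bar>n \<omega> (u k \<omega>) - ?x\<bar>) \<longlonglongrightarrow> 0"
        proof (rule squeeze_zero[OF elim(4)])
          show "\<bar>n \<omega> (u k \<omega>) - ?x\<bar> \<le> ndist (B.fib \<omega>) (B.emb (u k) \<omega>) (f \<omega>)" for k
            using Bw.abs_nrm_diff[OF Bw.embed_carr elim(3), of "u k \<omega>"] by simp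
        qed simp
        then have "(\<lambda>k. n \<omega> (u k \<omega>)) \<longlonglongrightarrow> ?x"
          by (simp add: tendsto_rabs_zero_iff LIM_zero_iff)
        then have lim_a: "(\<lambda>k. a * n \<omega> (u k \<omega>)) \<longlonglongrightarrow> a * ?x"
          by (rule tendsto_mult_left)
        have "(\<lambda>k. \<bar>nrm (D.fib \<omega>) (Q \<omega> (B.emb (u k) \<omega>)) - ?y\<bar>) \<longlonglongrightarrow> 0"
        proof (rule squeeze_zero)
          show "(\<lambda>k. ndist (D.fib \<omega>) (Q \<omega> (B.emb (u k) \<omega>)) (Q \<omega> (f \<omega>))) \<longlonglongrightarrow> 0"
            by (rule Q_tendsto[OF elim(1,2) Bw.embed_carr elim(3,4)])
        qed (simp, rule Dw.abs_nrm_diff[OF carrs[OF Bw.embed_carr] carrs[OF elim(3)]])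
        then have lim_y: "(\<lambda>k. nrm (D.fib \<omega>) (Q \<omega> (B.emb (u k) \<omega>))) \<longlonglongrightarrow> ?y"
          by (simp add: tendsto_rabs_zero_iff LIM_zero_iff)
        have "nrm (D.fib \<omega>) (Q \<omega> (B.emb (u k) \<omega>)) \<le> a * n \<omega> (u k \<omega>)" for k
          using elim(5)[rule_format, of k] real Bw.n_nonneg[of "u k \<omega>"]
          by (simp add: ennreal_mult[symmetric] ennreal_le_iff)
        then have "?y \<le> a * ?x"
          by (intro LIMSEQ_le[OF lim_y lim_a]) blast
        then show ?thesis
          using real x_nonneg by (simp add: ennreal_mult[symmetric] ennreal_leI)
      next
        case top
        then show ?thesis using x x_nonneg by (simp add: ennreal_top_mult)
      qed
    qed
  qed
qed

end

section \<open>Sufficiency: Hoelder's inequality from Young's\<close>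

lemma Young_powr:
  fixes x y :: real
  assumes "1 \<le> q" "q < p" "0 \<le> x" "0 \<le> y"
  shows "x powr q * y powr q \<le> x powr (p * q / (p - q)) + y powr p"
proof -
  \<comment> \<open>These conjugate exponents turn the q-th powers into the powers r = pq / (p - q)
    and p. Their reciprocals as factors are below 1 and are dropped.\<close>
  let ?a = "p / (p - q)" and ?b = "p / q"
  have a: "?a > 1" and b: "?b > 1" and ab: "1 / ?a + 1 / ?b = 1"
    using assms(1,2) by (simp_all add: field_simps)
  have "x powr q * y powr q \<le> (x powr q) powr ?a / ?a + (y powr q) powr ?b / ?b"
    by (rule Youngs_inequality[OF a b ab]) simp_all
  also have "\<dots> \<le> (x powr q) powr ?a + (y powr q) powr ?b"
  proof (rule add_mono)
    show "(x powr q) powr ?a / ?a \<le> (x powr q) powr ?a"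
      using a divide_left_mono[of 1 ?a "(x powr q) powr ?a"] by simp
    show "(y powr q) powr ?b / ?b \<le> (y powr q) powr ?b"
      using b divide_left_mono[of 1 ?b "(y powr q) powr ?b"] by simp
  qed
  also have "\<dots> = x powr (p * q / (p - q)) + y powr p"
    using assms(1,2) by (simp add: powr_powr mult.commute)
  finally show ?thesis .
qed

context operator_family
begin

text \<open>Hoelder's inequality with the scale a left free: Young's inequality is applied pointwise
  to \<open>?H \<omega>\<close> and \<open>g \<omega> / a\<close>. Choosing a as the norm of f later
  restores homogeneity. The function g is a measurable version of the fibre norm of f.\<close>

lemma RN_integral_bound:
  assumes q: "1 \<le> q" "q < p"
    and f: "measurable_section M s n f"
    and g: "g \<in> borel_measurable M" "\<And>\<omega>. 0 \<le> g \<omega>" "AE \<omega> in M. nrm (B.fib \<omega>) (f \<omega>) = g \<omega>"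
    and a: "a > 0"
  shows "section_int N t l q (\<lambda>\<omega>. Q \<omega> (f \<omega>)) \<le> ennreal (a powr q) *
    ((\<integral>\<^sup>+ \<omega>. enn_powr (RN \<omega> * enn_powr (J \<omega>) (1 / q)) (p * q / (p - q)) \<partial>M)
      + ennreal (a powr - p) * section_int M s n p f)"
proof -
  let ?H = "\<lambda>\<omega>. RN \<omega> * enn_powr (J \<omega>) (1 / q)"
  let ?r = "p * q / (p - q)"
  note [measurable] = RN_measurable g(1)
  have sf: "section_int M s n p f = (\<integral>\<^sup>+ \<omega>. ennreal (g \<omega> powr p) \<partial>M)"
    unfolding section_int_def
    by (rule nn_integral_cong_AE) (use g(3) in \<open>eventually_elim, simp\<close>)
  have "AE \<omega> in M. ennreal (nrm (D.fib \<omega>) (Q \<omega> (f \<omega>)) powr q)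
      \<le> enn_powr (RN \<omega>) q * ennreal (g \<omega> powr q)"
    using AE_space Q_bounded_operator B.measurable_section_carr[OF f] RN_bound[OF f] g(3)
  proof eventually_elim
    case (elim \<omega>)
    interpret Dw: seminormed t "l \<omega>" by (rule D.fibre) (simp add: space_N elim)
    note c = Q_carr[OF elim(1-3)]
    have "0 \<le> nrm (D.fib \<omega>) (Q \<omega> (f \<omega>))" by (rule Dw.nrm_nonneg[OF c c])
    then have "ennreal (nrm (D.fib \<omega>) (Q \<omega> (f \<omega>)) powr q) = enn_powr (ennreal (nrm (D.fib \<omega>) (Q \<omega> (f \<omega>)))) q"
      by (simp add: enn_powr_ennreal)
    also have "\<dots> \<le> enn_powr (RN \<omega> * ennreal (g \<omega>)) q"
      using elim(4,5) q by (intro enn_powr_mono) simp_all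
    also have "\<dots> = enn_powr (RN \<omega>) q * ennreal (g \<omega> powr q)"
      using q g(2) by (simp add: enn_powr_mult enn_powr_ennreal)
    finally show ?case .
  qed
  then have "AE \<omega> in N. ennreal (nrm (D.fib \<omega>) (Q \<omega> (f \<omega>)) powr q)
      \<le> enn_powr (RN \<omega>) q * ennreal (g \<omega> powr q)" by (rule AE_N)
  then have "section_int N t l q (\<lambda>\<omega>. Q \<omega> (f \<omega>)) \<le> (\<integral>\<^sup>+ \<omega>. enn_powr (RN \<omega>) q * ennreal (g \<omega> powr q) \<partial>N)"
    unfolding section_int_def by (rule nn_integral_mono_AE)
  also have "\<dots> = (\<integral>\<^sup>+ \<omega>. J \<omega> * (enn_powr (RN \<omega>) q * ennreal (g \<omega> powr q)) \<partial>M)"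
    by (rule nn_integral_N) measurable
  also have "\<dots> \<le> (\<integral>\<^sup>+ \<omega>. ennreal (a powr q) *
      (enn_powr (?H \<omega>) ?r + ennreal (a powr - p) * ennreal (g \<omega> powr p)) \<partial>M)"
  proof (rule nn_integral_mono)
    fix \<omega>
    \<comment> \<open>The density J is absorbed as the q-th power of J^(1/q); this is the origin of
      that factor in the criterion.\<close>
    have "J \<omega> * (enn_powr (RN \<omega>) q * ennreal (g \<omega> powr q)) = enn_powr (?H \<omega>) q * ennreal (g \<omega> powr q)"
      using q by (simp add: enn_powr_mult enn_powr_powr enn_powr_one mult_ac)
    also have "\<dots> \<le> ennreal (a powr q) *
      (enn_powr (?H \<omega>) ?r + ennreal (a powr - p) * ennreal (g \<omega> powr p))"
    proof (cases "?H \<omega>")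
      case (real h)
      have "h powr q * g \<omega> powr q = a powr q * (h powr q * (g \<omega> / a) powr q)"
        using a g(2)[of \<omega>] by (simp add: powr_divide)
      also have "\<dots> \<le> a powr q * (h powr ?r + (g \<omega> / a) powr p)"
        using q a g(2)[of \<omega>] real by (intro mult_left_mono Young_powr) simp_all
      also have "(g \<omega> / a) powr p = a powr - p * g \<omega> powr p"
        using a g(2)[of \<omega>] by (simp add: powr_divide powr_minus_divide)
      finally have "ennreal (h powr q * g \<omega> powr q)
          \<le> ennreal (a powr q * (h powr ?r + a powr - p * g \<omega> powr p))"
        by (rule ennreal_leI)
      then show ?thesis
        using real by (simp add: enn_powr_ennreal ennreal_mult ennreal_plus)
    next
      case top
      have "ennreal (a powr q) * top = top"
        using a by (simp add: ennreal_mult_top)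
      then show ?thesis
        unfolding top by (simp add: enn_powr_top)
    qed
    finally show "J \<omega> * (enn_powr (RN \<omega>) q * ennreal (g \<omega> powr q)) \<le> ennreal (a powr q) *
      (enn_powr (?H \<omega>) ?r + ennreal (a powr - p) * ennreal (g \<omega> powr p))" .
  qed
  also have "\<dots> = ennreal (a powr q) * (\<integral>\<^sup>+ \<omega>. enn_powr (?H \<omega>) ?r + ennreal (a powr - p) * ennreal (g \<omega> powr p) \<partial>M)"
    by (rule nn_integral_cmult) measurable
  also have "(\<integral>\<^sup>+ \<omega>. enn_powr (?H \<omega>) ?r + ennreal (a powr - p) * ennreal (g \<omega> powr p) \<partial>M)
      = (\<integral>\<^sup>+ \<omega>. enn_powr (?H \<omega>) ?r \<partial>M) + (\<integral>\<^sup>+ \<omega>. ennreal (a powr - p) * ennreal (g \<omega> powr p) \<partial>M)"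
    by (rule nn_integral_add) measurable
  also have "(\<integral>\<^sup>+ \<omega>. ennreal (a powr - p) * ennreal (g \<omega> powr p) \<partial>M) = ennreal (a powr - p) * section_int M s n p f"
    unfolding sf by (rule nn_integral_cmult) measurable
  finally show ?thesis .
qed

lemma Q_Lp_bound:
  assumes q: "1 \<le> q" "q < p"
    and fin: "(\<integral>\<^sup>+ \<omega>. enn_powr (RN \<omega> * enn_powr (J \<omega>) (1 / q)) (p * q / (p - q)) \<partial>M) < \<infinity>"
  obtains C where "\<And>f. measurable_section M s n f \<Longrightarrow> section_int M s n p f < \<infinity> \<Longrightarrow>
    section_int N t l q (\<lambda>\<omega>. Q \<omega> (f \<omega>)) < \<infinity> \<and>
    enn2real (section_int N t l q (\<lambda>\<omega>. Q \<omega> (f \<omega>))) powr (1 / q)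
      \<le> C * enn2real (section_int M s n p f) powr (1 / p)"
proof -
  obtain K where K: "0 \<le> K"
    "(\<integral>\<^sup>+ \<omega>. enn_powr (RN \<omega> * enn_powr (J \<omega>) (1 / q)) (p * q / (p - q)) \<partial>M) = ennreal K"
    using fin by (cases "\<integral>\<^sup>+ \<omega>. enn_powr (RN \<omega> * enn_powr (J \<omega>) (1 / q)) (p * q / (p - q)) \<partial>M") auto
  show thesis
  \<comment> \<open>With a the norm of f, the correction term \<open>a powr - p * A\<close> equals
    1, hence the factor K + 1.\<close>
  proof (rule that[of "(K + 1) powr (1 / q)"])
    fix f assume f: "measurable_section M s n f" "section_int M s n p f < \<infinity>"
    let ?I = "section_int N t l q (\<lambda>\<omega>. Q \<omega> (f \<omega>))"
    obtain A where A: "0 \<le> A" "section_int M s n p f = ennreal A"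
      using f(2) by (cases "section_int M s n p f") auto
    obtain g where g: "g \<in> borel_measurable M" "\<And>\<omega>. 0 \<le> g \<omega>" "AE \<omega> in M. nrm (B.fib \<omega>) (f \<omega>) = g \<omega>"
      by (rule B.section_nrm[OF f(1)]) (rule that)
    have bound: "?I \<le> ennreal (a powr q * (K + a powr - p * A))" if "a > 0" for a
      using RN_integral_bound[OF q f(1) g that] K(1) A(1)
      unfolding K(2) A(2) by (simp add: ennreal_mult ennreal_plus)
    have fin_I: "?I < \<infinity>"
      using bound[of 1] by (auto intro: le_less_trans)
    then obtain I where I: "0 \<le> I" "?I = ennreal I"
      by (cases ?I) auto
    have bound': "I \<le> a powr q * (K + a powr - p * A)" if "a > 0" for a
      using bound[OF that] I K(1) A(1) by (simp add: ennreal_le_iff)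
    have "I powr (1 / q) \<le> (K + 1) powr (1 / q) * A powr (1 / p)"
    proof (cases "A = 0")
      case True
      \<comment> \<open>A section of norm 0 does not allow a to be its norm. Instead a ranges over
        all \<open>b powr (1 / q)\<close> with b > 0, which forces I = 0.\<close>
      have le: "I \<le> b * K" if "b > 0" for b
        using bound'[of "b powr (1 / q)"] that q True by (simp add: powr_powr)
      have "I \<le> 0"
      proof (rule ccontr)
        assume "\<not> I \<le> 0"
        then have "I > 0" by simp
        \<comment> \<open>This b contradicts I > 0 also when K = 0.\<close>
        moreover have "I / (K + 1) * K < I"
          using \<open>I > 0\<close> K(1) by (simp add: field_simps)
        ultimately show False using le[of "I / (K + 1)"] K(1) by simp
      qed
      then show ?thesis using I(1) by simp
    next
      case False
      let ?a = "A powr (1 / p)"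
      have a: "?a > 0" using False A(1) by simp
      have "?a powr - p * A = 1"
        using False A(1) q by (simp add: powr_powr powr_minus)
      then have "I \<le> ?a powr q * (K + 1)"
        using bound'[OF a] by simp
      then have "I powr (1 / q) \<le> (?a powr q * (K + 1)) powr (1 / q)"
        using I(1) q by (intro powr_mono2) simp_all
      also have "\<dots> = (?a powr q) powr (1 / q) * (K + 1) powr (1 / q)"
        by (rule powr_mult)
      also have "(?a powr q) powr (1 / q) = ?a"
        using a q by (simp add: powr_powr)
      finally show ?thesis by (simp add: mult.commute)
    qed
    with fin_I show "?I < \<infinity> \<and> enn2real ?I powr (1 / q)
        \<le> (K + 1) powr (1 / q) * enn2real (section_int M s n p f) powr (1 / p)"
      using I A by simp
  qed
qed

section \<open>Bounds on sections and operators on classes\<close>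

lemma induces_if_bound:
  assumes bound: "\<And>f. measurable_section M s n f \<Longrightarrow> section_int M s n p f < \<infinity> \<Longrightarrow>
    section_int N t l q (\<lambda>\<omega>. Q \<omega> (f \<omega>)) < \<infinity> \<and>
    enn2real (section_int N t l q (\<lambda>\<omega>. Q \<omega> (f \<omega>))) powr (1 / q)
      \<le> C * enn2real (section_int M s n p f) powr (1 / p)"
  shows "induces_bounded_operator M s n p N t l q Q"
proof -
  \<comment> \<open>The union over representatives is a single class: sections equal M-a.e. have
    images equal M-a.e., hence N-a.e.\<close>
  define T where "T F = (\<Union>f\<in>F. D.scls (\<lambda>\<omega>. Q \<omega> (f \<omega>)))" for F
  have T: "T (B.scls f) = D.scls (\<lambda>\<omega>. Q \<omega> (f \<omega>))" if f: "measurable_section M s n f" for f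
    unfolding T_def
  proof (rule SUP_eq_const[OF B.scls_nonempty[OF f]])
    fix g assume "g \<in> B.scls f"
    then have "AE \<omega> in M. f \<omega> = g \<omega>" unfolding B.in_scls by blast
    then have "AE \<omega> in M. Q \<omega> (f \<omega>) = Q \<omega> (g \<omega>)" by eventually_elim simp
    then show "D.scls (\<lambda>\<omega>. Q \<omega> (g \<omega>)) = D.scls (\<lambda>\<omega>. Q \<omega> (f \<omega>))"
      by (intro D.scls_eq[OF section_Q[OF f]] AE_N)
  qed
  have "bounded_operator (direct_integral_Lp M s n p) (direct_integral_Lp N t l q) T"
    unfolding bounded_operator_def
  proof (intro conjI ballI allI)
    fix F assume "F \<in> carr (direct_integral_Lp M s n p)"
    then obtain f where f: "F = B.scls f" "measurable_section M s n f" "section_int M s n p f < \<infinity>"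
      unfolding B.in_carr_Lp by blast
    show "T F \<in> carr (direct_integral_Lp N t l q)"
      unfolding D.in_carr_Lp f(1) T[OF f(2)] using section_Q[OF f(2)] bound[OF f(2,3)] by blast
    show "T (scl (direct_integral_Lp M s n p) c F) = scl (direct_integral_Lp N t l q) c (T F)" for c
      unfolding f(1) B.scl_Lp[OF f(2)] T[OF f(2)] D.scl_Lp[OF section_Q[OF f(2)]]
        T[OF B.section_scl[OF f(2)]]
    proof (rule D.scls_eq[OF D.section_scl[OF section_Q[OF f(2)]]], rule AE_N)
      show "AE \<omega> in M. scl (D.fib \<omega>) c (Q \<omega> (f \<omega>)) = Q \<omega> (scl (B.fib \<omega>) c (f \<omega>))"
        using AE_space Q_bounded_operator B.measurable_section_carr[OF f(2)]
        by eventually_elim (rule Q_scl[symmetric])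
    qed
    fix G assume "G \<in> carr (direct_integral_Lp M s n p)"
    then obtain g where g: "G = B.scls g" "measurable_section M s n g"
      unfolding B.in_carr_Lp by blast
    show "T (add (direct_integral_Lp M s n p) F G) = add (direct_integral_Lp N t l q) (T F) (T G)"
      unfolding f(1) g(1) B.add_Lp[OF f(2) g(2)] T[OF f(2)] T[OF g(2)]
        D.add_Lp[OF section_Q[OF f(2)] section_Q[OF g(2)]] T[OF B.section_add[OF f(2) g(2)]]
    proof (rule D.scls_eq[OF D.section_add[OF section_Q[OF f(2)] section_Q[OF g(2)]]], rule AE_N)
      show "AE \<omega> in M. add (D.fib \<omega>) (Q \<omega> (f \<omega>)) (Q \<omega> (g \<omega>)) = Q \<omega> (add (B.fib \<omega>) (f \<omega>) (g \<omega>))"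
        using AE_space Q_bounded_operator B.measurable_section_carr[OF f(2)]
          B.measurable_section_carr[OF g(2)]
        by eventually_elim (rule Q_add[symmetric])
    qed
  next
    show "\<exists>C. \<forall>F\<in>carr (direct_integral_Lp M s n p).
        nrm (direct_integral_Lp N t l q) (T F) \<le> C * nrm (direct_integral_Lp M s n p) F"
    proof (intro exI ballI)
      fix F assume "F \<in> carr (direct_integral_Lp M s n p)"
      then obtain f where f: "F = B.scls f" "measurable_section M s n f" "section_int M s n p f < \<infinity>"
        unfolding B.in_carr_Lp by blast
      show "nrm (direct_integral_Lp N t l q) (T F) \<le> C * nrm (direct_integral_Lp M s n p) F"
        unfolding f(1) T[OF f(2)] B.nrm_Lp[OF f(2)] D.nrm_Lp[OF section_Q[OF f(2)]]
        using bound[OF f(2,3)] by blast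
    qed
  qed
  moreover have "(\<lambda>\<omega>. Q \<omega> (f \<omega>)) \<in> T F" if F: "F \<in> carr (direct_integral_Lp M s n p)" "f \<in> F" for F f
  proof -
    obtain h where "F = B.scls h"
      using F(1) unfolding B.in_carr_Lp by blast
    then have "measurable_section M s n f"
      using F(2) B.in_scls by blast
    from D.scls_self[OF section_Q[OF this]] show ?thesis
      unfolding T_def using F(2) by blast
  qed
  ultimately show ?thesis unfolding induces_bounded_operator_def by blast
qed

lemma bound_if_induces:
  assumes "induces_bounded_operator M s n p N t l q Q"
  obtains C where "0 \<le> C" "\<And>f. measurable_section M s n f \<Longrightarrow> section_int M s n p f < \<infinity> \<Longrightarrow>
    section_int N t l q (\<lambda>\<omega>. Q \<omega> (f \<omega>)) < \<infinity> \<and>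
    enn2real (section_int N t l q (\<lambda>\<omega>. Q \<omega> (f \<omega>))) powr (1 / q)
      \<le> C * enn2real (section_int M s n p f) powr (1 / p)"
proof -
  obtain T where T: "bounded_operator (direct_integral_Lp M s n p) (direct_integral_Lp N t l q) T"
    and QT: "\<forall>F\<in>carr (direct_integral_Lp M s n p). \<forall>f\<in>F. (\<lambda>\<omega>. Q \<omega> (f \<omega>)) \<in> T F"
    using assms unfolding induces_bounded_operator_def by blast
  from T have T_carr: "\<forall>F\<in>carr (direct_integral_Lp M s n p). T F \<in> carr (direct_integral_Lp N t l q)"
    unfolding bounded_operator_def by blast
  from T have "\<exists>C. \<forall>F\<in>carr (direct_integral_Lp M s n p).
      nrm (direct_integral_Lp N t l q) (T F) \<le> C * nrm (direct_integral_Lp M s n p) F"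
    unfolding bounded_operator_def by (elim conjE)
  then obtain C where C: "\<forall>F\<in>carr (direct_integral_Lp M s n p).
      nrm (direct_integral_Lp N t l q) (T F) \<le> C * nrm (direct_integral_Lp M s n p) F" ..
  show thesis
  proof (rule that[of "max C 0"])
    fix f assume f: "measurable_section M s n f" "section_int M s n p f < \<infinity>"
    have F: "B.scls f \<in> carr (direct_integral_Lp M s n p)"
      unfolding B.in_carr_Lp using f by blast
    obtain g where g: "T (B.scls f) = D.scls g" "measurable_section N t l g" "section_int N t l q g < \<infinity>"
      using bspec[OF T_carr F] unfolding D.in_carr_Lp by blast
    \<comment> \<open>T is only known to exist, but its value contains Q f, so the norm of that
      value is computed from Q f.\<close>
    have "(\<lambda>\<omega>. Q \<omega> (f \<omega>)) \<in> D.scls g"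
      using bspec[OF bspec[OF QT F] B.scls_self[OF f(1)]] unfolding g(1) .
    then have "AE \<omega> in N. g \<omega> = Q \<omega> (f \<omega>)" unfolding D.in_scls by blast
    then have eq: "section_int N t l q g = section_int N t l q (\<lambda>\<omega>. Q \<omega> (f \<omega>))"
      by (rule D.section_int_cong)
    have "enn2real (section_int N t l q g) powr (1 / q) \<le> C * enn2real (section_int M s n p f) powr (1 / p)"
      using bspec[OF C F] unfolding g(1) B.nrm_Lp[OF f(1)] D.nrm_Lp[OF g(2)] .
    also have "\<dots> \<le> max C 0 * enn2real (section_int M s n p f) powr (1 / p)"
      by (intro mult_right_mono) simp_all
    finally show "section_int N t l q (\<lambda>\<omega>. Q \<omega> (f \<omega>)) < \<infinity> \<and>
      enn2real (section_int N t l q (\<lambda>\<omega>. Q \<omega> (f \<omega>))) powr (1 / q)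
      \<le> max C 0 * enn2real (section_int M s n p f) powr (1 / p)"
      using g(3) unfolding eq by blast
  qed simp
qed

section \<open>Necessity: test sections for the random norm\<close>

lemma Q_emb_nrm:
  obtains \<psi> where "\<psi> \<in> borel_measurable M" "\<And>\<omega>. 0 \<le> \<psi> \<omega>"
    "AE \<omega> in N. nrm (D.fib \<omega>) (Q \<omega> (embed (n \<omega>) v)) = \<psi> \<omega>"
proof -
  have "measurable_section N t l (\<lambda>\<omega>. Q \<omega> (embed (n \<omega>) v))"
    by (rule section_Q_emb) (rule countably_valued_const)
  then show thesis
    by (rule D.section_nrm) (rule that, simp_all add: borel_measurable_N)
qed

text \<open>The quotients are replaced by versions \<phi> that agree with them N-a.e. and are
  M-measurable everywhere, so a countable essential supremum exists. Minimality of the random norm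
  then compares it with this supremum on \<open>{J > 0}\<close>.\<close>

lemma RN_countable_supremum:
  obtains \<phi> :: "nat \<Rightarrow> 'o \<Rightarrow> real" and c :: "nat \<Rightarrow> 'v"
  where "\<And>i. \<phi> i \<in> borel_measurable M" "\<And>i \<omega>. \<omega> \<in> space M \<Longrightarrow> 0 \<le> \<phi> i \<omega>"
    "\<And>i. AE \<omega> in N. nrm (D.fib \<omega>) (Q \<omega> (embed (n \<omega>) (c i))) / n \<omega> (c i) = \<phi> i \<omega>"
    "AE \<omega> in M. 0 < J \<omega> \<longrightarrow> RN \<omega> \<le> (SUP i. ennreal (\<phi> i \<omega>))"
proof -
  have "\<forall>v. \<exists>\<psi>. \<psi> \<in> borel_measurable M \<and> (\<forall>\<omega>. 0 \<le> \<psi> \<omega>) \<and>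
    (AE \<omega> in N. nrm (D.fib \<omega>) (Q \<omega> (embed (n \<omega>) v)) = \<psi> \<omega>)"
    by (rule allI) (rule Q_emb_nrm, blast)
  from choice[OF this] obtain \<psi> where "\<forall>v. \<psi> v \<in> borel_measurable M \<and> (\<forall>\<omega>. 0 \<le> \<psi> v \<omega>) \<and>
    (AE \<omega> in N. nrm (D.fib \<omega>) (Q \<omega> (embed (n \<omega>) v)) = \<psi> v \<omega>)" ..
  then have \<psi>: "\<And>v. \<psi> v \<in> borel_measurable M" "\<And>v \<omega>. 0 \<le> \<psi> v \<omega>"
    and Q_\<psi>: "\<And>v. AE \<omega> in N. nrm (D.fib \<omega>) (Q \<omega> (embed (n \<omega>) v)) = \<psi> v \<omega>"
    by blast+
  \<comment> \<open>Division by 0 gives 0 as in the random norm, so the quotients agree wherever the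
    numerators do.\<close>
  define \<phi> where "\<phi> v \<omega> = \<psi> v \<omega> / n \<omega> v" for v \<omega>
  have \<phi>: "\<phi> v \<in> borel_measurable M" for v
    unfolding \<phi>_def using \<psi>(1) B.n_measurable by (intro borel_measurable_divide)
  have \<phi>_nonneg: "0 \<le> \<phi> v \<omega>" if "\<omega> \<in> space M" for v \<omega>
    unfolding \<phi>_def using \<psi>(2) seminormed.n_nonneg[OF B.fibre[OF that]] by (intro divide_nonneg_nonneg)
  have Q_\<phi>: "AE \<omega> in N. nrm (D.fib \<omega>) (Q \<omega> (embed (n \<omega>) v)) / n \<omega> v = \<phi> v \<omega>" for v
    using Q_\<psi>[of v] by eventually_elim (simp add: \<phi>_def)
  obtain c :: "nat \<Rightarrow> 'v" where c: "\<And>v. AE \<omega> in M. ennreal (\<phi> v \<omega>) \<le> (SUP i. ennreal (\<phi> (c i) \<omega>))"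
    by (rule sigma_finite_measure.countable_essential_supremum[OF sigma_finite,
          of "\<lambda>v \<omega>. ennreal (\<phi> v \<omega>)"]) (use \<phi> in simp, rule that)
  define S where "S \<omega> = (SUP i. ennreal (\<phi> (c i) \<omega>))" for \<omega>
  \<comment> \<open>The value top on \<open>{J = 0}\<close> makes S' a majorant of all quotients
    M-a.e., although \<phi> says nothing about them there.\<close>
  define S' where "S' \<omega> = (if J \<omega> = 0 then top else S \<omega>)" for \<omega>
  have S_meas: "S \<in> borel_measurable M"
    unfolding S_def using \<phi> by simp
  have "{\<omega> \<in> space M. J \<omega> = 0} = J -` {0} \<inter> space M" by auto
  also have "\<dots> \<in> sets M" by (rule measurable_sets[OF borel_measurable_RN_deriv]) simp
  finally have S'_meas: "S' \<in> borel_measurable M"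
    unfolding S'_def using S_meas by (intro measurable_If) simp_all
  have "AE \<omega> in M. ennreal (nrm (D.fib \<omega>) (Q \<omega> (embed (n \<omega>) v)) / nrm (B.fib \<omega>) (embed (n \<omega>) v)) \<le> S' \<omega>"
    for v
    using AE_space Q_\<phi>[of v, unfolded AE_N_iff] c[of v]
  proof eventually_elim
    case (elim \<omega>)
    show ?case
    proof (cases "J \<omega> = 0")
      case False
      then have "0 < J \<omega>" by (simp add: zero_less_iff_neq_zero)
      with elim(2) have "nrm (D.fib \<omega>) (Q \<omega> (embed (n \<omega>) v)) / n \<omega> v = \<phi> v \<omega>" by blast
      with elim(3) False show ?thesis
        by (simp add: seminormed.nrm_embed[OF B.fibre[OF elim(1)]] S'_def S_def)
    qed (simp add: S'_def)
  qed
  then have "AE \<omega> in M. RN \<omega> \<le> S' \<omega>"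
    using RN_lattice_sup[unfolded is_lattice_sup_def, THEN conjunct2, THEN conjunct2, THEN bspec,
        OF S'_meas] by blast
  then have "AE \<omega> in M. 0 < J \<omega> \<longrightarrow> RN \<omega> \<le> (SUP i. ennreal (\<phi> (c i) \<omega>))"
    by eventually_elim (auto simp: S'_def S_def split: if_splits)
  then show thesis
    by (rule that[of "\<lambda>i. \<phi> (c i)" c, rotated 3]) (fact \<phi>, fact \<phi>_nonneg, fact Q_\<phi>)
qed

text \<open>
  The coefficient \<open>w = G powr (r / p)\<close> of the test section is chosen such that both \<open>w powr p\<close> and
  \<open>(w * G) powr q\<close> are \<open>G powr r\<close>.
\<close>

lemma truncated_RN_bound:
  fixes \<phi> :: "nat \<Rightarrow> 'o \<Rightarrow> real" and c :: "nat \<Rightarrow> 'v" and G :: "'o \<Rightarrow> real"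
  assumes q: "1 \<le> q" "q < p"
    and bound: "\<And>f. measurable_section M s n f \<Longrightarrow> section_int M s n p f < \<infinity> \<Longrightarrow>
      section_int N t l q (\<lambda>\<omega>. Q \<omega> (f \<omega>)) < \<infinity> \<and>
      enn2real (section_int N t l q (\<lambda>\<omega>. Q \<omega> (f \<omega>))) powr (1 / q)
        \<le> C * enn2real (section_int M s n p f) powr (1 / p)"
    and \<phi>: "\<And>i. \<phi> i \<in> borel_measurable M" "\<And>i \<omega>. \<omega> \<in> space M \<Longrightarrow> 0 \<le> \<phi> i \<omega>"
    and Q\<phi>: "\<And>i. AE \<omega> in N. nrm (D.fib \<omega>) (Q \<omega> (embed (n \<omega>) (c i))) / n \<omega> (c i) = \<phi> i \<omega>"
    and G: "G \<in> borel_measurable M" "\<And>\<omega>. 0 \<le> G \<omega>"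
    and G_le: "\<And>\<omega>. \<omega> \<in> space M \<Longrightarrow> \<exists>i\<le>k. ennreal (G \<omega>) \<le> ennreal (\<phi> i \<omega>) * enn_powr (J \<omega>) (1 / q)"
    and fin: "(\<integral>\<^sup>+ \<omega>. ennreal (G \<omega> powr (p * q / (p - q))) \<partial>M) < \<infinity>"
  shows "(\<integral>\<^sup>+ \<omega>. ennreal (G \<omega> powr (p * q / (p - q))) \<partial>M) \<le> ennreal (C powr (p * q / (p - q)))"
proof -
  let ?r = "p * q / (p - q)"
  have r_p: "?r / p * p = ?r" and r_q: "?r / p * q + q = ?r"
    using q by (simp_all add: field_simps)
  let ?P = "\<lambda>i \<omega>. ennreal (G \<omega>) \<le> ennreal (\<phi> i \<omega>) * enn_powr (J \<omega>) (1 / q)"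
  \<comment> \<open>Taking the least admissible index makes the choice measurable in
    \<omega>.\<close>
  define I where "I \<omega> = (LEAST i. ?P i \<omega>)" for \<omega>
  define w where "w \<omega> = G \<omega> powr (?r / p)" for \<omega>
  \<comment> \<open>Normalizes the vector to length w. Where the seminorm of the vector is 0, a is 0
    by division, so the test section has norm at most w and not always equal to w.\<close>
  define a where "a \<omega> = w \<omega> / n \<omega> (c (I \<omega>))" for \<omega>
  note [measurable] = \<phi>(1) G(1)
  have I_P: "?P (I \<omega>) \<omega>" if "\<omega> \<in> space M" for \<omega>
    unfolding I_def using G_le[OF that] by (auto intro: LeastI)
  have I: "countably_valued M I"
    unfolding I_def by (rule countably_valued_count_space) measurable
  have cI: "countably_valued M (\<lambda>\<omega>. c (I \<omega>))"
    by (rule countably_valued_comp[OF I])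
  have w: "w \<in> borel_measurable M" "\<And>\<omega>. 0 \<le> w \<omega>"
    unfolding w_def by simp_all
  have a: "a \<in> borel_measurable M"
    unfolding a_def using w(1) B.n_countably_valued[OF cI] by (rule borel_measurable_divide)
  let ?f = "B.emb (\<lambda>\<omega>. s (of_real (a \<omega>)) (c (I \<omega>)))"
  have f: "measurable_section M s n ?f"
    by (rule B.section_scaled[OF a cI])
  have nrm_f: "nrm (B.fib \<omega>) (?f \<omega>) \<le> w \<omega>" "0 \<le> nrm (B.fib \<omega>) (?f \<omega>)" if "\<omega> \<in> space M" for \<omega>
  proof -
    interpret Bw: seminormed s "n \<omega>" by (rule B.fibre) (rule that)
    show "0 \<le> nrm (B.fib \<omega>) (?f \<omega>)" by (simp add: Bw.n_nonneg)
    have "nrm (B.fib \<omega>) (?f \<omega>) = \<bar>a \<omega>\<bar> * n \<omega> (c (I \<omega>))"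
      by (simp only: Bw.nrm_embed Bw.n_scale norm_of_real)
    also have "\<dots> \<le> w \<omega>"
      using w(2)[of \<omega>] Bw.n_nonneg[of "c (I \<omega>)"] by (simp add: a_def)
    finally show "nrm (B.fib \<omega>) (?f \<omega>) \<le> w \<omega>" .
  qed
  define K where "K = enn2real (\<integral>\<^sup>+ \<omega>. ennreal (G \<omega> powr ?r) \<partial>M)"
  have K: "(\<integral>\<^sup>+ \<omega>. ennreal (G \<omega> powr ?r) \<partial>M) = ennreal K" "0 \<le> K"
    unfolding K_def using fin by simp_all
  have "section_int M s n p ?f \<le> (\<integral>\<^sup>+ \<omega>. ennreal (w \<omega> powr p) \<partial>M)"
    unfolding section_int_def using nrm_f q by (intro nn_integral_mono ennreal_leI powr_mono2) simp_all
  also have "\<dots> = ennreal K"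
    unfolding w_def K(1)[symmetric] powr_powr r_p ..
  finally have f_le: "section_int M s n p ?f \<le> ennreal K" .
  then have f_fin: "section_int M s n p ?f < \<infinity>"
    by (auto intro: le_less_trans)
  have f_le': "enn2real (section_int M s n p ?f) \<le> K"
    by (rule enn2real_leI[OF K(2) f_le])
  have "AE \<omega> in M. \<forall>i. 0 < J \<omega> \<longrightarrow> nrm (D.fib \<omega>) (Q \<omega> (embed (n \<omega>) (c i))) / n \<omega> (c i) = \<phi> i \<omega>"
    unfolding AE_all_countable using Q\<phi> unfolding AE_N_iff by blast
  then have nrm_Qf: "AE \<omega> in M. 0 < J \<omega> \<longrightarrow> nrm (D.fib \<omega>) (Q \<omega> (?f \<omega>)) = w \<omega> * \<phi> (I \<omega>) \<omega>"
    using AE_space Q_bounded_operator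
  proof (eventually_elim, intro impI)
    fix \<omega>
    assume \<omega>: "\<forall>i. 0 < J \<omega> \<longrightarrow> nrm (D.fib \<omega>) (Q \<omega> (embed (n \<omega>) (c i))) / n \<omega> (c i) = \<phi> i \<omega>"
      "\<omega> \<in> space M" "bounded_operator (B.fib \<omega>) (D.fib \<omega>) (Q \<omega>)" "0 < J \<omega>"
    interpret Bw: seminormed s "n \<omega>" by (rule B.fibre) (rule \<omega>)
    interpret Dw: seminormed t "l \<omega>" by (rule D.fibre) (simp add: space_N \<omega>)
    let ?e = "embed (n \<omega>) (c (I \<omega>))"
    note Qe = Q_carr[OF \<omega>(2,3) Bw.embed_carr[of "c (I \<omega>)"]]
    have "Q \<omega> (?f \<omega>) = scl (D.fib \<omega>) (of_real (a \<omega>)) (Q \<omega> ?e)"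
      using Q_scl[OF \<omega>(2,3) Bw.embed_carr, of "of_real (a \<omega>)" "c (I \<omega>)"] by simp
    then have "nrm (D.fib \<omega>) (Q \<omega> (?f \<omega>)) = \<bar>a \<omega>\<bar> * nrm (D.fib \<omega>) (Q \<omega> ?e)"
      by (simp only: Dw.nrm_scl[OF Qe Qe] norm_of_real)
    \<comment> \<open>Both sides are 0 where the seminorm vanishes, so no case distinction is
      needed.\<close>
    also have "\<dots> = w \<omega> * (nrm (D.fib \<omega>) (Q \<omega> ?e) / n \<omega> (c (I \<omega>)))"
      using w(2)[of \<omega>] Bw.n_nonneg[of "c (I \<omega>)"] by (simp add: a_def)
    also have "nrm (D.fib \<omega>) (Q \<omega> ?e) / n \<omega> (c (I \<omega>)) = \<phi> (I \<omega>) \<omega>"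
      using \<omega>(1,4) by blast
    finally show "nrm (D.fib \<omega>) (Q \<omega> (?f \<omega>)) = w \<omega> * \<phi> (I \<omega>) \<omega>" .
  qed
  have \<phi>I: "(\<lambda>\<omega>. \<phi> (I \<omega>) \<omega>) \<in> borel_measurable M"
    by (rule borel_measurable_countably_valued[OF I, of \<phi>]) (rule \<phi>(1))
  have "ennreal K \<le> (\<integral>\<^sup>+ \<omega>. J \<omega> * ennreal ((w \<omega> * \<phi> (I \<omega>) \<omega>) powr q) \<partial>M)"
    unfolding K(1)[symmetric]
  proof (rule nn_integral_mono)
    fix \<omega> assume \<omega>: "\<omega> \<in> space M"
    \<comment> \<open>One part of the power is spent on the coefficient; the other,
      \<open>G \<omega> powr q\<close>, is bounded through the chosen quotient and releases a full
      factor J, which changes the integral to N.\<close>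
    have "G \<omega> powr ?r = w \<omega> powr q * G \<omega> powr q"
      unfolding w_def powr_powr powr_add[symmetric] r_q ..
    then have "ennreal (G \<omega> powr ?r) = ennreal (w \<omega> powr q) * enn_powr (ennreal (G \<omega>)) q"
      using G(2) by (simp add: ennreal_mult enn_powr_ennreal)
    also have "\<dots> \<le> ennreal (w \<omega> powr q) * enn_powr (ennreal (\<phi> (I \<omega>) \<omega>) * enn_powr (J \<omega>) (1 / q)) q"
      using I_P[OF \<omega>] q by (intro mult_left_mono enn_powr_mono) simp_all
    also have "\<dots> = J \<omega> * ennreal ((w \<omega> * \<phi> (I \<omega>) \<omega>) powr q)"
      using q \<phi>(2)[OF \<omega>] w(2)
      by (simp add: enn_powr_mult enn_powr_powr enn_powr_one enn_powr_ennreal powr_mult ennreal_mult mult_ac)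
    finally show "ennreal (G \<omega> powr ?r) \<le> J \<omega> * ennreal ((w \<omega> * \<phi> (I \<omega>) \<omega>) powr q)" .
  qed
  also have "\<dots> = (\<integral>\<^sup>+ \<omega>. ennreal ((w \<omega> * \<phi> (I \<omega>) \<omega>) powr q) \<partial>N)"
    using w(1) \<phi>I by (intro nn_integral_N[symmetric]) measurable
  also have "\<dots> = section_int N t l q (\<lambda>\<omega>. Q \<omega> (?f \<omega>))"
    unfolding section_int_def
  proof (rule nn_integral_cong_AE)
    have "AE \<omega> in N. nrm (D.fib \<omega>) (Q \<omega> (?f \<omega>)) = w \<omega> * \<phi> (I \<omega>) \<omega>"
      using nrm_Qf unfolding AE_N_iff .
    then show "AE \<omega> in N. ennreal ((w \<omega> * \<phi> (I \<omega>) \<omega>) powr q)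
        = ennreal (nrm (D.fib \<omega>) (Q \<omega> (?f \<omega>)) powr q)"
      by eventually_elim simp
  qed
  finally have Qf_ge: "ennreal K \<le> section_int N t l q (\<lambda>\<omega>. Q \<omega> (?f \<omega>))" .
  note bf = bound[OF f f_fin]
  have K_le: "K \<le> enn2real (section_int N t l q (\<lambda>\<omega>. Q \<omega> (?f \<omega>)))"
    using enn2real_mono[OF Qf_ge] bf K(2) by simp
  \<comment> \<open>The sign of C is read off the bound itself: a negative C would force a negative
    norm for the image.\<close>
  have C: "0 \<le> C" if "0 < enn2real (section_int M s n p ?f)"
  proof (rule ccontr)
    assume "\<not> 0 \<le> C"
    then have "C * enn2real (section_int M s n p ?f) powr (1 / p) < 0"
      using that by (simp add: mult_neg_pos)
    then show False using bf powr_ge_zero by (meson not_le order_trans)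
  qed
  show ?thesis
  proof (cases "K = 0")
    case False
    then have K_pos: "0 < K" using K(2) by simp
    have pos: "0 < K powr (1 / q)" using K_pos by simp
    have "K powr (1 / q) \<le> enn2real (section_int N t l q (\<lambda>\<omega>. Q \<omega> (?f \<omega>))) powr (1 / q)"
      using K_le K(2) q by (intro powr_mono2) simp_all
    also have "\<dots> \<le> C * enn2real (section_int M s n p ?f) powr (1 / p)"
      using bf by blast
    finally have le: "K powr (1 / q) \<le> C * enn2real (section_int M s n p ?f) powr (1 / p)" .
    have C_nonneg: "0 \<le> C"
    proof (rule C)
      have "enn2real (section_int M s n p ?f) \<noteq> 0" using le pos by auto
      then show "0 < enn2real (section_int M s n p ?f)" by (simp add: less_le)
    qed
    note le
    also have "C * enn2real (section_int M s n p ?f) powr (1 / p) \<le> C * K powr (1 / p)"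
      using f_le' q C_nonneg by (intro mult_left_mono powr_mono2) simp_all
    \<comment> \<open>The absorption step: K is finite and positive, and 1 / q - 1 / p = 1 /
      r.\<close>
    finally have "K powr (1 / q) / K powr (1 / p) \<le> C"
      using K_pos by (simp add: divide_le_eq)
    also have "K powr (1 / q) / K powr (1 / p) = K powr (1 / ?r)"
      using q by (simp add: powr_diff[symmetric] diff_divide_distrib)
    finally have "(K powr (1 / ?r)) powr ?r \<le> C powr ?r"
      using q by (intro powr_mono2) simp_all
    moreover have "(K powr (1 / ?r)) powr ?r = K"
      using q K_pos by (simp add: powr_powr)
    ultimately show ?thesis
      unfolding K(1) by (simp add: ennreal_leI)
  qed (simp add: K(1))
qed

lemma in_Lp_if_bound:
  assumes q: "1 \<le> q" "q < p"
    and bound: "\<And>f. measurable_section M s n f \<Longrightarrow> section_int M s n p f < \<infinity> \<Longrightarrow>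
      section_int N t l q (\<lambda>\<omega>. Q \<omega> (f \<omega>)) < \<infinity> \<and>
      enn2real (section_int N t l q (\<lambda>\<omega>. Q \<omega> (f \<omega>))) powr (1 / q)
        \<le> C * enn2real (section_int M s n p f) powr (1 / p)"
  shows "(\<integral>\<^sup>+ \<omega>. enn_powr (RN \<omega> * enn_powr (J \<omega>) (1 / q)) (p * q / (p - q)) \<partial>M) < \<infinity>"
proof -
  let ?r = "p * q / (p - q)"
  have r: "?r > 0" using q by simp
  obtain \<phi> :: "nat \<Rightarrow> 'o \<Rightarrow> real" and c :: "nat \<Rightarrow> 'v"
    where \<phi>: "\<And>i. \<phi> i \<in> borel_measurable M" "\<And>i \<omega>. \<omega> \<in> space M \<Longrightarrow> 0 \<le> \<phi> i \<omega>"
      and Q\<phi>: "\<And>i. AE \<omega> in N. nrm (D.fib \<omega>) (Q \<omega> (embed (n \<omega>) (c i))) / n \<omega> (c i) = \<phi> i \<omega>"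
      and RN_le: "AE \<omega> in M. 0 < J \<omega> \<longrightarrow> RN \<omega> \<le> (SUP i. ennreal (\<phi> i \<omega>))"
    by (rule RN_countable_supremum) (rule that)
  obtain A :: "nat \<Rightarrow> 'o set" where A: "range A \<subseteq> sets M" "(\<Union>i. A i) = space M"
      "\<And>i. emeasure M (A i) \<noteq> \<infinity>" "incseq A"
    by (rule sigma_finite_measure.sigma_finite_incseq[OF sigma_finite]) (rule that)
  let ?J = "\<lambda>\<omega>. enn_powr (J \<omega>) (1 / q)"
  define X where "X k \<omega> = (SUP i\<in>{..k}. ennreal (\<phi> i \<omega>) * ?J \<omega>)" for k \<omega>
  \<comment> \<open>Three truncations act together: finitely many indices, so that the maximum is
    attained at some i; height at most k; and support in a set of finite measure. The last two make
    the integral of \<open>G k powr r\<close> finite.\<close>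
  define H where "H k \<omega> = indicator (A k) \<omega> * min (of_nat k) (X k \<omega>)" for k \<omega>
  define G where "G k \<omega> = enn2real (H k \<omega>)" for k \<omega>
  have [measurable]: "A k \<in> sets M" for k using A(1) by blast
  note [measurable] = \<phi>(1)
  have [measurable]: "X k \<in> borel_measurable M" for k
    unfolding X_def by measurable
  have [measurable]: "H k \<in> borel_measurable M" for k
    unfolding H_def by measurable
  have [measurable]: "G k \<in> borel_measurable M" for k
    unfolding G_def by measurable
  have H_le: "H k \<omega> \<le> of_nat k * indicator (A k) \<omega>" "H k \<omega> \<le> X k \<omega>" for k \<omega>
    unfolding H_def by (auto simp: indicator_def)
  have G: "ennreal (G k \<omega>) = H k \<omega>" for k \<omega>
  proof -
    have "H k \<omega> < top"
      using H_le(1)[of k \<omega>] by (rule le_less_trans) (simp add: indicator_def of_nat_less_top)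
    then show ?thesis unfolding G_def by simp
  qed
  have X_mono: "X k \<omega> \<le> X k' \<omega>" if "k \<le> k'" for k k' \<omega>
    unfolding X_def using that by (intro SUP_subset_mono) auto
  have H_mono: "H k \<omega> \<le> H (Suc k) \<omega>" for k \<omega>
    unfolding H_def
  proof (intro mult_mono min.mono X_mono)
    show "indicator (A k) \<omega> \<le> (indicator (A (Suc k)) \<omega> :: ennreal)"
      using incseq_SucD[OF A(4), of k] by (auto simp: indicator_def)
  qed simp_all
  have int_fin: "(\<integral>\<^sup>+ \<omega>. ennreal (G k \<omega> powr ?r) \<partial>M) < \<infinity>" for k
  proof -
    have "G k \<omega> powr ?r \<le> real k powr ?r * indicator (A k) \<omega>" for \<omega>
    proof (cases "\<omega> \<in> A k")
      case True
      have "G k \<omega> \<le> real k"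
        unfolding G_def using H_le(1)[of k \<omega>] True
        by (intro enn2real_leI) (simp_all add: ennreal_of_nat_eq_real_of_nat)
      then show ?thesis using True r by (simp add: powr_mono2 G_def)
    next
      case False
      then show ?thesis using H_le(1)[of k \<omega>] by (simp add: G_def)
    qed
    then have "ennreal (G k \<omega> powr ?r) \<le> ennreal (real k powr ?r) * indicator (A k) \<omega>" for \<omega>
      using ennreal_leI[of "G k \<omega> powr ?r" "real k powr ?r * indicator (A k) \<omega>"]
      by (simp add: ennreal_mult ennreal_indicator)
    then have "(\<integral>\<^sup>+ \<omega>. ennreal (G k \<omega> powr ?r) \<partial>M)
        \<le> (\<integral>\<^sup>+ \<omega>. ennreal (real k powr ?r) * indicator (A k) \<omega> \<partial>M)"
      by (intro nn_integral_mono)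
    also have "\<dots> = ennreal (real k powr ?r) * emeasure M (A k)"
      by (rule nn_integral_cmult_indicator) simp
    also have "\<dots> < \<infinity>"
      using A(3)[of k] by (simp add: ennreal_mult_less_top less_top)
    finally show ?thesis .
  qed
  have int_le: "(\<integral>\<^sup>+ \<omega>. ennreal (G k \<omega> powr ?r) \<partial>M) \<le> ennreal (C powr ?r)" for k
  proof (rule truncated_RN_bound[OF q bound \<phi> Q\<phi> _ _ _ int_fin, where k = k])
    show "0 \<le> G k \<omega>" for \<omega> unfolding G_def by simp
    fix \<omega> assume "\<omega> \<in> space M"
    let ?Y = "\<lambda>i. ennreal (\<phi> i \<omega>) * ?J \<omega>"
    have "X k \<omega> = Max (?Y ` {..k})"
      unfolding X_def by (rule cSup_eq_Max) auto
    also have "\<dots> \<in> ?Y ` {..k}" by (rule Max_in) auto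
    finally obtain i where "i \<le> k" "X k \<omega> = ?Y i" by blast
    then show "\<exists>i\<le>k. ennreal (G k \<omega>) \<le> ?Y i"
      using H_le(2)[of k \<omega>] unfolding G by auto
  qed simp_all
  have "AE \<omega> in M. enn_powr (RN \<omega> * ?J \<omega>) ?r \<le> (SUP k. ennreal (G k \<omega> powr ?r))"
    using AE_space RN_le
  proof eventually_elim
    case (elim \<omega>)
    show ?case
    \<comment> \<open>The supremum is compared before taking powers; it remains to recover RN times
      J^(1/q) from the truncations H k.\<close>
    proof (rule enn_powr_SUP_le[OF r])
      show "enn_powr (H k \<omega>) ?r \<le> (SUP k. ennreal (G k \<omega> powr ?r))" for k
        unfolding G[symmetric]
        by (rule SUP_upper2[of k]) (simp_all add: enn_powr_ennreal G_def)
      have SUP_H: "ennreal (\<phi> i \<omega>) * ?J \<omega> \<le> (SUP k. H k \<omega>)" for i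
      proof -
        obtain j where j: "\<omega> \<in> A j" using A(2) elim(1) by blast
        let ?y = "ennreal (\<phi> i \<omega>) * ?J \<omega>"
        have "min (of_nat m) ?y \<le> (SUP k. H k \<omega>)" for m
        \<comment> \<open>This index is large enough for the height m, for the quotient i and for
          the set A j containing \<omega>.\<close>
        proof (rule SUP_upper2[of "max m (max i j)"])
          let ?k = "max m (max i j)"
          have "\<omega> \<in> A ?k" by (rule subsetD[OF incseqD[OF A(4)] j]) simp
          moreover have "min (of_nat m) ?y \<le> min (of_nat ?k) (X ?k \<omega>)"
            unfolding X_def by (intro min.mono SUP_upper) simp_all
          ultimately show "min (of_nat m) ?y \<le> H ?k \<omega>"
            unfolding H_def by simp
        qed simp
        then have "(SUP m. min (of_nat m) ?y) \<le> (SUP k. H k \<omega>)"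
          by (rule SUP_least)
        \<comment> \<open>Also valid for an infinite value, which can occur where J is top.\<close>
        moreover have "(SUP m. min (of_nat m) ?y) = ?y"
          by (simp add: inf_min[symmetric] SUP_inf[symmetric] ennreal_SUP_of_nat_eq_top)
        ultimately show ?thesis by simp
      qed
      show "RN \<omega> * ?J \<omega> \<le> (SUP k. H k \<omega>)"
      \<comment> \<open>Where J = 0 the random norm may even be top; the product is 0 all the
        same.\<close>
      proof (cases "J \<omega> = 0")
        case True
        then have "?J \<omega> = 0" by (simp add: enn_powr_eq_0_iff)
        then show ?thesis by simp
      next
        case False
        then have "RN \<omega> \<le> (SUP i. ennreal (\<phi> i \<omega>))"
          using elim(2) by (simp add: zero_less_iff_neq_zero)
        then have "RN \<omega> * ?J \<omega> \<le> (SUP i. ennreal (\<phi> i \<omega>)) * ?J \<omega>"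
          by (rule mult_right_mono) simp
        also have "\<dots> = (SUP i. ennreal (\<phi> i \<omega>) * ?J \<omega>)"
          by (simp add: SUP_mult_right_ennreal)
        also have "\<dots> \<le> (SUP k. H k \<omega>)"
          by (rule SUP_least) (rule SUP_H)
        finally show ?thesis .
      qed
    qed
  qed
  then have "(\<integral>\<^sup>+ \<omega>. enn_powr (RN \<omega> * ?J \<omega>) ?r \<partial>M) \<le> (\<integral>\<^sup>+ \<omega>. (SUP k. ennreal (G k \<omega> powr ?r)) \<partial>M)"
    by (rule nn_integral_mono_AE)
  also have "\<dots> = (SUP k. \<integral>\<^sup>+ \<omega>. ennreal (G k \<omega> powr ?r) \<partial>M)"
  proof (rule nn_integral_monotone_convergence_SUP)
    have "G k \<omega> \<le> G (Suc k) \<omega>" for k \<omega>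
      using H_mono[of k \<omega>] unfolding G[symmetric] by (simp add: G_def)
    then show "incseq (\<lambda>k \<omega>. ennreal (G k \<omega> powr ?r))"
      using r by (intro incseq_SucI le_funI ennreal_leI powr_mono2) (simp_all add: G_def)
  qed measurable
  also have "\<dots> \<le> ennreal (C powr ?r)"
    by (rule SUP_least) (rule int_le)
  finally show ?thesis by (auto intro: le_less_trans)
qed

end

theorem theorem3p8:
  fixes p q :: real
    and d :: "'o \<Rightarrow> 'o \<Rightarrow> real"
    and m \<mu> \<nu> :: "'o measure"
    and sV :: "'k::real_normed_field \<Rightarrow> 'v::ab_group_add \<Rightarrow> 'v"
    and nB :: "'o \<Rightarrow> 'v \<Rightarrow> real"
    and sW :: "'k \<Rightarrow> 'w::ab_group_add \<Rightarrow> 'w"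
    and nD :: "'o \<Rightarrow> 'w \<Rightarrow> real"
    and Q :: "'o \<Rightarrow> (nat \<Rightarrow> 'v) set \<Rightarrow> (nat \<Rightarrow> 'w) set"
  assumes "1 \<le> q" and "q < p"
    and "homogeneous_space d m"
    and "sets \<mu> = sets m" and "sigma_finite_measure \<mu>"
    and "sets \<nu> = sets m" and "absolutely_continuous \<mu> \<nu>"
    and "measurable_banach_family \<mu> sV nB"
    and "measurable_banach_family \<nu> sW nD"
    and "measurable_operator_family \<mu> sV nB \<nu> sW nD Q"
  shows "induces_bounded_operator \<mu> sV nB p \<nu> sW nD q Q \<longleftrightarrow>
    in_Lp \<mu> (p * q / (p - q))
      (\<lambda>\<omega>. random_norm \<mu> sV nB sW nD Q \<omega> * enn_powr (RN_deriv \<mu> \<nu> \<omega>) (1 / q))"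
proof -
  obtain L where L: "finite_measure L" "sets L = sets \<mu>" "absolutely_continuous L \<mu>"
    by (rule finite_measure_same_null_sets[OF assms(5)]) (rule that)
  interpret operator_family \<mu> \<nu> L sV nB sW nD Q
    by (rule operator_family.intro) (use assms L in simp_all)
  \<comment> \<open>\<open>in_Lp\<close> also asks for measurability, which a lattice supremum has
    by definition; only finiteness of the integral is at stake in the equivalence.\<close>
  have "RN \<in> borel_measurable \<mu>" by (rule RN_measurable)
  then have "(\<lambda>\<omega>. RN \<omega> * enn_powr (J \<omega>) (1 / q)) \<in> borel_measurable \<mu>"
    by measurable
  moreover have "induces_bounded_operator \<mu> sV nB p \<nu> sW nD q Q \<longleftrightarrow>
    (\<integral>\<^sup>+ \<omega>. enn_powr (RN \<omega> * enn_powr (J \<omega>) (1 / q)) (p * q / (p - q)) \<partial>\<mu>) < \<infinity>"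
  proof
    assume "induces_bounded_operator \<mu> sV nB p \<nu> sW nD q Q"
    then show "(\<integral>\<^sup>+ \<omega>. enn_powr (RN \<omega> * enn_powr (J \<omega>) (1 / q)) (p * q / (p - q)) \<partial>\<mu>) < \<infinity>"
      by (rule bound_if_induces) (rule in_Lp_if_bound[OF assms(1,2)])
  next
    assume "(\<integral>\<^sup>+ \<omega>. enn_powr (RN \<omega> * enn_powr (J \<omega>) (1 / q)) (p * q / (p - q)) \<partial>\<mu>) < \<infinity>"
    then show "induces_bounded_operator \<mu> sV nB p \<nu> sW nD q Q"
      by (rule Q_Lp_bound[OF assms(1,2)]) (rule induces_if_bound)
  qed
  ultimately show ?thesis unfolding in_Lp_def by blast
qed

end
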